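(* Let $(V,[,],\mathbf 1)$ be a unital Leibniz algebra over a field $\Bbbk$. The braiding $\sigma_{[,]}(v\otimes w)=w\otimes v+\mathbf 1\otimes[v,w]$ and a braided character $\epsilon$ for $(V,\sigma_{[,]})$ (for instance, a Lie character) define the following differential on $T(V)$: $${}^{\epsilon}d(v_1\ldots v_n)=\epsilon(\mathbf 1)\sum_{1\le i<j\le n}(-1)^{j-1}v_1\ldots v_{i-1}[v_i,v_j]v_{i+1}\ldots\widehat{v_j}\ldots v_n+\sum_{1\le j\le n}(-1)^{j-1}\epsilon(v_j)v_1\ldots\widehat{v_j}\ldots v_n.$$ It is the total differential $\sum_{j=1}^n(-1)^{j-1}d_{n;j}$ of the pre-simplicial structure $$d_{n;j}(v_1\ldots v_n)=\epsilon(\mathbf 1)\sum_{1\le i<j}v_1\ldots v_{i-1}[v_i,v_j]v_{i+1}\ldots\widehat{v_j}\ldots v_n+\epsilon(v_j)v_1\ldots\widehat{v_j}\ldots v_n,$$ which, if $V\simeq V'\oplus\Bbbk\mathbf 1$ is split, is completed into a weakly simplicial one by the linear maps $s_{n;i}$, $1\le i\le n$, determined by $$s_{n;i}(v_1\ldots v_n)=\begin{cases}v_1\ldots v_{i-1}\mathbf 1v_i\ldots v_n+v_1\ldots v_i\mathbf 1v_{i+1}\ldots v_n&\text{if }v_i\in V',\\ v_1\ldots v_{i-1}\mathbf 1\mathbf 1v_{i+1}\ldots v_n&\text{if }v_i=\mathbf 1.\end{cases}$$ The complex $(T(V),{}^{\epsilon}d)$ is acyclic if $\epsilon(\mathbf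 1)=1$.
   Context: $T(V)=\bigoplus_{n\ge0}V^{\otimes n}$, $V^{\otimes0}=\Bbbk$, $v_1\ldots v_n$ denotes $v_1\otimes\cdots\otimes v_n$; the differential vanishes on $V^{\otimes0}$. A unital Leibniz algebra is a vector space $V$ with a bilinear bracket satisfying $[v,[w,u]]=[[v,w],u]-[[v,u],w]$ for all $v,w,u$, and an element $\mathbf 1$ with $[\mathbf 1,v]=[v,\mathbf 1]=0$ for all $v$. It is split if there is a Leibniz subalgebra $V'\subset V$ with $V=V'\oplus\Bbbk\mathbf 1$ (a Leibniz algebra decomposition, $\Bbbk\mathbf 1$ one-dimensional). A braided character for $(V,\sigma)$ is $\epsilon\in V^*$ with $(\epsilon\otimes\epsilon)\circ\sigma=\epsilon\otimes\epsilon$; a Lie character is $\epsilon\in V^*$ with $\epsilon([v,w])=0$ for all $v,w$ and $\epsilon(\mathbf 1)=1$. With $\sigma=\sigma_{[,]}$ and $\sigma_i$ denoting $\sigma$ applied to factors $i,i+1$, the left braided differential attached to $\epsilon$ is ${}^{\epsilon}d=\sum_{j=1}^n(-1)^{j-1}(\epsilon\otimes\mathrm{Id}_{V^{\otimes(n-1)}})\circ\sigma_1\circ\sigma_2\circ\cdots\circ\sigma_{j-1}$ on $V^{\otimes n}$. Simplicial vocabulary, for $V_n=V^{\otimes n}$ with linear maps $d_{n;i}:V_n\to V_{n-1}$, $s_{n;i}:V_n\to V_{n+1}$, $1\le i\le n$ (first subscripts omitted, composites having source $V_n$): pre-simplicial: $d_id_j=d_{j-1}d_i$ for $1\le i<j\le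 n$; weakly simplicial: moreover $s_is_j=s_{j+1}s_i$ for $1\le i\le j\le n$, $d_is_j=s_{j-1}d_i$ for $1\le i<j\le n$, $d_is_j=s_jd_{i-1}$ for $1\le j$, $j+1<i\le n+1$, and $d_is_i=d_{i+1}s_i$ for $1\le i\le n$. *)

theory Defs
  imports "HOL-Library.Poly_Mapping" "HOL-Library.Set_Algebras" "HOL-Library.FuncSet"
    "HOL.Vector_Spaces"
begin

section \<open>The tensor algebra of a vector space\<close>

text \<open>
  A vector space over a field is a scalar multiplication on a whole type, as in
  \<^locale>\<open>vector_space\<close>. Its tensor algebra \<open>T(V)\<close> is the quotient of the free vector space on
  all words over \<open>V\<close> by the subspace spanned by the multilinearity relations. Its elements
  are cosets, added by the elementwise sum from \<^theory>\<open>HOL-Library.Set_Algebras\<close>; the zero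
  coset is the subspace of relations itself.
\<close>

type_synonym ('k, 'v) words = "'v list \<Rightarrow>\<^sub>0 'k"

definition word :: "'v list \<Rightarrow> ('k::field, 'v) words"
  where "word vs = Poly_Mapping.single vs 1"

definition free_scale :: "'k::field \<Rightarrow> ('k, 'v) words \<Rightarrow> ('k, 'v) words"
  where "free_scale c x = Poly_Mapping.map ((*) c) x"

definition multilinear_relations ::
    "('k::field \<Rightarrow> 'v::ab_group_add \<Rightarrow> 'v) \<Rightarrow> ('k, 'v) words set" where
  "multilinear_relations scale = module.span free_scale
     ({word (us @ [v + w] @ ws) - word (us @ [v] @ ws) - word (us @ [w] @ ws) | us v w ws. True}
      \<union> {word (us @ [scale c v] @ ws) - free_scale c (word (us @ [v] @ ws)) | us c v ws. True})"

definition tensor_class ::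
    "('k::field \<Rightarrow> 'v::ab_group_add \<Rightarrow> 'v) \<Rightarrow> ('k, 'v) words \<Rightarrow> ('k, 'v) words set"
  where "tensor_class scale x = x +o multilinear_relations scale"

definition pure_tensor ::
    "('k::field \<Rightarrow> 'v::ab_group_add \<Rightarrow> 'v) \<Rightarrow> 'v list \<Rightarrow> ('k, 'v) words set"
  where "pure_tensor scale vs = tensor_class scale (word vs)"

text \<open>
  The relations are homogeneous, so the classes of combinations of words of length \<open>n\<close> form the
  component \<open>V\<^sup>\<otimes>\<^sup>n\<close> of \<open>T(V)\<close>. For \<open>n = 0\<close> these are the multiples of \<open>pure_tensor scale []\<close>,
  the unit of the ground field.
\<close>

definition tensor_power ::
    "('k::field \<Rightarrow> 'v::ab_group_add \<Rightarrow> 'v) \<Rightarrow> nat \<Rightarrow> ('k, 'v) words set set" where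
  "tensor_power scale n = tensor_class scale ` {x. \<forall>vs\<in>Poly_Mapping.keys x. length vs = n}"

definition tensor_zero ::
    "('k::field \<Rightarrow> 'v::ab_group_add \<Rightarrow> 'v) \<Rightarrow> ('k, 'v) words set"
  where "tensor_zero scale = tensor_class scale 0"

text \<open>
  Adding the subspace of relations changes nothing in \<open>tensor_scale\<close> for \<open>c \<noteq> 0\<close> and in
  \<open>tensor_sum\<close> for \<open>I \<noteq> {}\<close>; in the remaining cases it turns \<open>{0}\<close> into the zero coset.
\<close>

definition tensor_scale ::
    "('k::field \<Rightarrow> 'v::ab_group_add \<Rightarrow> 'v) \<Rightarrow> 'k \<Rightarrow> ('k, 'v) words set \<Rightarrow> ('k, 'v) words set"
  where "tensor_scale scale c A = free_scale c ` A + multilinear_relations scale"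

definition tensor_sum ::
    "('k::field \<Rightarrow> 'v::ab_group_add \<Rightarrow> 'v) \<Rightarrow> ('i \<Rightarrow> ('k, 'v) words set) \<Rightarrow> 'i set
      \<Rightarrow> ('k, 'v) words set"
  where "tensor_sum scale f I = (\<Sum>i\<in>I. f i) + multilinear_relations scale"

definition free_concat :: "('k::field, 'v) words \<Rightarrow> ('k, 'v) words \<Rightarrow> ('k, 'v) words" where
  "free_concat x y = (\<Sum>us\<in>Poly_Mapping.keys x. \<Sum>ws\<in>Poly_Mapping.keys y.
     Poly_Mapping.single (us @ ws) (Poly_Mapping.lookup x us * Poly_Mapping.lookup y ws))"

definition tensor_prod ::
    "('k::field \<Rightarrow> 'v::ab_group_add \<Rightarrow> 'v)
      \<Rightarrow> ('k, 'v) words set \<Rightarrow> ('k, 'v) words set \<Rightarrow> ('k, 'v) words set" where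
  "tensor_prod scale A B = {free_concat x y | x y. x \<in> A \<and> y \<in> B} + multilinear_relations scale"

text \<open>
  Linear maps from \<open>V\<^sup>\<otimes>\<^sup>m\<close> to \<open>V\<^sup>\<otimes>\<^sup>n\<close>. Extensionality makes equality of such maps the same as
  equality on \<open>V\<^sup>\<otimes>\<^sup>m\<close>.
\<close>

definition tensor_hom ::
    "('k::field \<Rightarrow> 'v::ab_group_add \<Rightarrow> 'v) \<Rightarrow> nat \<Rightarrow> nat
      \<Rightarrow> (('k, 'v) words set \<Rightarrow> ('k, 'v) words set) set" where
  "tensor_hom scale m n =
     {f \<in> tensor_power scale m \<rightarrow>\<^sub>E tensor_power scale n.
        (\<forall>A\<in>tensor_power scale m. \<forall>B\<in>tensor_power scale m. f (A + B) = f A + f B) \<and>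
        (\<forall>c. \<forall>A\<in>tensor_power scale m.
            f (tensor_scale scale c A) = tensor_scale scale c (f A))}"

text \<open>
  The linear map with prescribed values on pure tensors. It exists, and is then unique, exactly
  if the prescription \<open>g\<close> is multilinear on words of length \<open>m\<close>, with values in \<open>V\<^sup>\<otimes>\<^sup>n\<close>.
\<close>

definition tensor_lift ::
    "('k::field \<Rightarrow> 'v::ab_group_add \<Rightarrow> 'v) \<Rightarrow> nat \<Rightarrow> nat \<Rightarrow> ('v list \<Rightarrow> ('k, 'v) words set)
      \<Rightarrow> ('k, 'v) words set \<Rightarrow> ('k, 'v) words set" where
  "tensor_lift scale m n g =
     (THE f. f \<in> tensor_hom scale m n \<and> (\<forall>vs. length vs = m \<longrightarrow> f (pure_tensor scale vs) = g vs))"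


section \<open>Braidings, braided characters and braided differentials\<close>

text \<open>
  \<open>braiding_at scale \<sigma> n i\<close> is \<open>\<sigma>\<close> applied to the factors \<open>i\<close> and \<open>i + 1\<close> of \<open>V\<^sup>\<otimes>\<^sup>n\<close>, where factors
  are numbered from 1 (so that factor \<open>i\<close> of \<open>vs\<close> is \<open>vs ! (i - 1)\<close>) and \<open>1 \<le> i < n\<close>.
\<close>

definition braiding_at ::
    "('k::field \<Rightarrow> 'v::ab_group_add \<Rightarrow> 'v) \<Rightarrow> (('k, 'v) words set \<Rightarrow> ('k, 'v) words set)
      \<Rightarrow> nat \<Rightarrow> nat \<Rightarrow> ('k, 'v) words set \<Rightarrow> ('k, 'v) words set" where
  "braiding_at scale \<sigma> n i = tensor_lift scale n n (\<lambda>vs.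
     tensor_prod scale (pure_tensor scale (take (i - 1) vs))
       (tensor_prod scale (\<sigma> (pure_tensor scale [vs ! (i - 1), vs ! i]))
         (pure_tensor scale (drop (i + 1) vs))))"

text \<open>A braiding is a solution of the Yang--Baxter equation; it need not be invertible.\<close>

definition is_braiding ::
    "('k::field \<Rightarrow> 'v::ab_group_add \<Rightarrow> 'v)
      \<Rightarrow> (('k, 'v) words set \<Rightarrow> ('k, 'v) words set) \<Rightarrow> bool" where
  "is_braiding scale \<sigma> \<longleftrightarrow>
     \<sigma> \<in> tensor_hom scale 2 2 \<and>
     (\<forall>A\<in>tensor_power scale 3.
        braiding_at scale \<sigma> 3 1 (braiding_at scale \<sigma> 3 2 (braiding_at scale \<sigma> 3 1 A)) =
        braiding_at scale \<sigma> 3 2 (braiding_at scale \<sigma> 3 1 (braiding_at scale \<sigma> 3 2 A)))"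

text \<open>The map \<open>\<epsilon> \<otimes> \<epsilon>\<close>, with the ground field as \<open>V\<^sup>\<otimes>\<^sup>0\<close>.\<close>

definition char_char ::
    "('k::field \<Rightarrow> 'v::ab_group_add \<Rightarrow> 'v) \<Rightarrow> ('v \<Rightarrow> 'k)
      \<Rightarrow> ('k, 'v) words set \<Rightarrow> ('k, 'v) words set" where
  "char_char scale \<epsilon> = tensor_lift scale 2 0 (\<lambda>vs.
     tensor_scale scale (\<epsilon> (vs ! 0) * \<epsilon> (vs ! 1)) (pure_tensor scale []))"

definition braided_character ::
    "('k::field \<Rightarrow> 'v::ab_group_add \<Rightarrow> 'v) \<Rightarrow> (('k, 'v) words set \<Rightarrow> ('k, 'v) words set)
      \<Rightarrow> ('v \<Rightarrow> 'k) \<Rightarrow> bool" where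
  "braided_character scale \<sigma> \<epsilon> \<longleftrightarrow>
     Vector_Spaces.linear scale (*) \<epsilon> \<and>
     (\<forall>A\<in>tensor_power scale 2. char_char scale \<epsilon> (\<sigma> A) = char_char scale \<epsilon> A)"

text \<open>The map \<open>\<epsilon> \<otimes> Id\<close> from \<open>V\<^sup>\<otimes>\<^sup>n\<close> to \<open>V\<^sup>\<otimes>\<^sup>(\<^sup>n\<^sup>-\<^sup>1\<^sup>)\<close> for \<open>n \<ge> 1\<close>.\<close>

definition char_left ::
    "('k::field \<Rightarrow> 'v::ab_group_add \<Rightarrow> 'v) \<Rightarrow> ('v \<Rightarrow> 'k) \<Rightarrow> nat
      \<Rightarrow> ('k, 'v) words set \<Rightarrow> ('k, 'v) words set" where
  "char_left scale \<epsilon> n = tensor_lift scale n (n - 1) (\<lambda>vs.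
     tensor_scale scale (\<epsilon> (hd vs)) (pure_tensor scale (tl vs)))"

text \<open>
  The \<open>foldr\<close> is \<open>\<sigma>\<^sub>1 \<circ> \<dots> \<circ> \<sigma>\<^bsub>j-1\<^esub>\<close>. On \<open>V\<^sup>\<otimes>\<^sup>0\<close> the sum is empty and the differential vanishes.
\<close>

definition left_braided_differential ::
    "('k::field \<Rightarrow> 'v::ab_group_add \<Rightarrow> 'v) \<Rightarrow> (('k, 'v) words set \<Rightarrow> ('k, 'v) words set)
      \<Rightarrow> ('v \<Rightarrow> 'k) \<Rightarrow> nat \<Rightarrow> ('k, 'v) words set \<Rightarrow> ('k, 'v) words set" where
  "left_braided_differential scale \<sigma> \<epsilon> n = (\<lambda>A\<in>tensor_power scale n.
     tensor_sum scale (\<lambda>j. tensor_scale scale ((-1) ^ (j - 1))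
       (char_left scale \<epsilon> n (foldr (\<circ>) (map (braiding_at scale \<sigma> n) [1..<j]) id A))) {1..n})"


section \<open>Differentials and simplicial structures on the tensor powers\<close>

text \<open>
  Because \<open>0 - 1 = 0\<close> on natural numbers, \<open>D 0\<close> has target \<open>V\<^sup>\<otimes>\<^sup>0\<close> instead of the zero space.
  As it is required to be zero, its kernel is the whole of \<open>V\<^sup>\<otimes>\<^sup>0\<close>.
\<close>

definition tensor_differential ::
    "('k::field \<Rightarrow> 'v::ab_group_add \<Rightarrow> 'v)
      \<Rightarrow> (nat \<Rightarrow> ('k, 'v) words set \<Rightarrow> ('k, 'v) words set) \<Rightarrow> bool" where
  "tensor_differential scale D \<longleftrightarrow>
     (\<forall>n. D n \<in> tensor_hom scale n (n - 1)) \<and>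
     (\<forall>A\<in>tensor_power scale 0. D 0 A = tensor_zero scale) \<and>
     (\<forall>n. \<forall>A\<in>tensor_power scale n. D (n - 1) (D n A) = tensor_zero scale)"

definition tensor_acyclic ::
    "('k::field \<Rightarrow> 'v::ab_group_add \<Rightarrow> 'v)
      \<Rightarrow> (nat \<Rightarrow> ('k, 'v) words set \<Rightarrow> ('k, 'v) words set) \<Rightarrow> bool" where
  "tensor_acyclic scale D \<longleftrightarrow>
     (\<forall>n. {A \<in> tensor_power scale n. D n A = tensor_zero scale} =
          D (n + 1) ` tensor_power scale (n + 1))"

definition pre_simplicial ::
    "('k::field \<Rightarrow> 'v::ab_group_add \<Rightarrow> 'v)
      \<Rightarrow> (nat \<Rightarrow> nat \<Rightarrow> ('k, 'v) words set \<Rightarrow> ('k, 'v) words set) \<Rightarrow> bool" where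
  "pre_simplicial scale d \<longleftrightarrow>
     (\<forall>n i. 1 \<le> i \<and> i \<le> n \<longrightarrow> d n i \<in> tensor_hom scale n (n - 1)) \<and>
     (\<forall>n i j. 1 \<le> i \<and> i < j \<and> j \<le> n \<longrightarrow>
        (\<forall>A\<in>tensor_power scale n. d (n - 1) i (d n j A) = d (n - 1) (j - 1) (d n i A)))"

definition weakly_simplicial ::
    "('k::field \<Rightarrow> 'v::ab_group_add \<Rightarrow> 'v)
      \<Rightarrow> (nat \<Rightarrow> nat \<Rightarrow> ('k, 'v) words set \<Rightarrow> ('k, 'v) words set)
      \<Rightarrow> (nat \<Rightarrow> nat \<Rightarrow> ('k, 'v) words set \<Rightarrow> ('k, 'v) words set) \<Rightarrow> bool" where
  "weakly_simplicial scale d s \<longleftrightarrow>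
     pre_simplicial scale d \<and>
     (\<forall>n i. 1 \<le> i \<and> i \<le> n \<longrightarrow> s n i \<in> tensor_hom scale n (n + 1)) \<and>
     (\<forall>n i j. 1 \<le> i \<and> i \<le> j \<and> j \<le> n \<longrightarrow>
        (\<forall>A\<in>tensor_power scale n. s (n + 1) i (s n j A) = s (n + 1) (j + 1) (s n i A))) \<and>
     (\<forall>n i j. 1 \<le> i \<and> i < j \<and> j \<le> n \<longrightarrow>
        (\<forall>A\<in>tensor_power scale n. d (n + 1) i (s n j A) = s (n - 1) (j - 1) (d n i A))) \<and>
     (\<forall>n i j. 1 \<le> j \<and> j + 1 < i \<and> i \<le> n + 1 \<longrightarrow>
        (\<forall>A\<in>tensor_power scale n. d (n + 1) i (s n j A) = s (n - 1) j (d n (i - 1) A))) \<and>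
     (\<forall>n i. 1 \<le> i \<and> i \<le> n \<longrightarrow>
        (\<forall>A\<in>tensor_power scale n. d (n + 1) i (s n i A) = d (n + 1) (i + 1) (s n i A)))"


section \<open>Unital Leibniz algebras\<close>

locale unital_leibniz = vector_space scale
  for scale :: "'k::field \<Rightarrow> 'v::ab_group_add \<Rightarrow> 'v" +
  fixes bracket :: "'v \<Rightarrow> 'v \<Rightarrow> 'v" and one :: 'v
  assumes linear_right: "Vector_Spaces.linear scale scale (\<lambda>w. bracket v w)"
    and linear_left: "Vector_Spaces.linear scale scale (\<lambda>v. bracket v w)"
    and leibniz: "bracket v (bracket w u) = bracket (bracket v w) u - bracket (bracket v u) w"
    and one_left: "bracket one v = 0"
    and one_right: "bracket v one = 0"

text \<open>
  The decomposition \<open>V = V' \<oplus> \<bbbk>\<one>\<close>. Since \<open>\<one>\<close> is central for the bracket, it is a decomposition of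
  Leibniz algebras as soon as \<open>V'\<close> is a subalgebra.
\<close>

definition leibniz_splitting ::
    "('k::field \<Rightarrow> 'v::ab_group_add \<Rightarrow> 'v) \<Rightarrow> ('v \<Rightarrow> 'v \<Rightarrow> 'v) \<Rightarrow> 'v \<Rightarrow> 'v set \<Rightarrow> bool" where
  "leibniz_splitting scale bracket one V' \<longleftrightarrow>
     module.subspace scale V' \<and>
     (\<forall>v\<in>V'. \<forall>w\<in>V'. bracket v w \<in> V') \<and>
     one \<noteq> 0 \<and>
     V' + module.span scale {one} = UNIV \<and>
     V' \<inter> module.span scale {one} = {0}"

definition lie_character ::
    "('k::field \<Rightarrow> 'v::ab_group_add \<Rightarrow> 'v) \<Rightarrow> ('v \<Rightarrow> 'v \<Rightarrow> 'v) \<Rightarrow> 'v \<Rightarrow> ('v \<Rightarrow> 'k) \<Rightarrow> bool" where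
  "lie_character scale bracket one \<epsilon> \<longleftrightarrow>
     Vector_Spaces.linear scale (*) \<epsilon> \<and> (\<forall>v w. \<epsilon> (bracket v w) = 0) \<and> \<epsilon> one = 1"

definition leibniz_braiding ::
    "('k::field \<Rightarrow> 'v::ab_group_add \<Rightarrow> 'v) \<Rightarrow> ('v \<Rightarrow> 'v \<Rightarrow> 'v) \<Rightarrow> 'v
      \<Rightarrow> ('k, 'v) words set \<Rightarrow> ('k, 'v) words set" where
  "leibniz_braiding scale bracket one = tensor_lift scale 2 2 (\<lambda>vs.
     pure_tensor scale [vs ! 1, vs ! 0] + pure_tensor scale [one, bracket (vs ! 0) (vs ! 1)])"

text \<open>
  The words \<open>v\<^sub>1\<dots>v\<^sub>n\<close> with \<open>v\<^sub>j\<close> omitted and, for \<open>i < j\<close>, in addition with \<open>v\<^sub>i\<close> replaced by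
  \<open>[v\<^sub>i, v\<^sub>j]\<close>; factors are numbered from 1.
\<close>

definition omit :: "nat \<Rightarrow> 'v list \<Rightarrow> 'v list"
  where "omit j vs = take (j - 1) vs @ drop j vs"

definition bracket_omit :: "('v \<Rightarrow> 'v \<Rightarrow> 'v) \<Rightarrow> nat \<Rightarrow> nat \<Rightarrow> 'v list \<Rightarrow> 'v list" where
  "bracket_omit bracket i j vs = omit j (vs[i - 1 := bracket (vs ! (i - 1)) (vs ! (j - 1))])"

text \<open>
  The two cases prescribe \<open>f\<close> only on pure tensors with \<open>v\<^sub>i\<close> in \<open>V'\<close> or equal to \<open>\<one>\<close>; linearity
  determines it elsewhere when \<open>V = V' \<oplus> \<bbbk>\<one>\<close>.
\<close>

definition leibniz_degeneracy ::
    "('k::field \<Rightarrow> 'v::ab_group_add \<Rightarrow> 'v) \<Rightarrow> 'v \<Rightarrow> 'v set \<Rightarrow> nat \<Rightarrow> nat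
      \<Rightarrow> (('k, 'v) words set \<Rightarrow> ('k, 'v) words set) \<Rightarrow> bool" where
  "leibniz_degeneracy scale one V' n i f \<longleftrightarrow>
     f \<in> tensor_hom scale n (n + 1) \<and>
     (\<forall>vs. length vs = n \<longrightarrow>
        (vs ! (i - 1) \<in> V' \<longrightarrow> f (pure_tensor scale vs) =
           pure_tensor scale (take (i - 1) vs @ [one] @ drop (i - 1) vs) +
           pure_tensor scale (take i vs @ [one] @ drop i vs)) \<and>
        (vs ! (i - 1) = one \<longrightarrow> f (pure_tensor scale vs) =
           pure_tensor scale (take (i - 1) vs @ [one, one] @ drop i vs)))"

end

theory Submission
  imports Defs
begin

text \<open>
  Moving the factor \<open>v\<^sub>j\<close> to the front of a word with \<open>\<sigma>(v \<otimes> w) = w \<otimes> v + \<one> \<otimes> [v, w]\<close> and then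
  applying \<open>\<epsilon>\<close> to the front produces \<open>\<epsilon>(v\<^sub>j)\<close> times the word without \<open>v\<^sub>j\<close>, plus \<open>\<epsilon>(\<one>)\<close> times the
  result of letting \<open>v\<^sub>j\<close> act by right multiplication, as a derivation, on the letters before it:
  a letter \<open>\<one>\<close> that has been split off passes through everything in front of it, because brackets
  with \<open>\<one>\<close> vanish (\<open>braid_chain_contract\<close>). This is the explicit formula for the faces.

  For the simplicial identities \<open>d\<^sub>i d\<^sub>j = d\<^bsub>j-1\<^esub> d\<^sub>i\<close>, let \<open>u\<close> and \<open>v\<close> be the letters removed. On the
  letters between them both sides agree trivially. On the letters before \<open>u\<close>, the left side
  has an extra contribution from the action of \<open>v\<close> on the letter \<open>u\<close>, which afterwards acts as
  \<open>[u, v]\<close>; the Leibniz identity \<open>R\<^sub>v R\<^sub>u - R\<^sub>u R\<^sub>v = R\<^bsub>[u,v]\<^esub>\<close> for right multiplications,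
  extended to words (\<open>ad_commutator\<close>), shows that it makes up for the different order of the two
  actions, up to a multiple of \<open>\<epsilon>(\<one>) \<epsilon>([u, v])\<close>. This number is zero precisely because \<open>\<epsilon>\<close> is a
  braided character (\<open>braided_character_iff\<close>). The alternating sum of the faces is then a
  differential. If \<open>\<epsilon>(\<one>) = 1\<close>, prefixing a word with \<open>\<one>\<close> is a contracting homotopy
  (\<open>pairing_D_insert_one\<close>).

  A splitting \<open>V = V' \<oplus> \<bbbk>\<one>\<close> is the same as a Lie character \<open>\<theta>\<close> with kernel \<open>V'\<close>
  (\<open>splitting_lie_character\<close>), and in terms of \<open>\<theta>\<close> both cases in the definition of the
  degeneracies are given by the formula \<open>v \<mapsto> \<one> v + v \<one> - \<theta>(v) \<one> \<one>\<close>.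

  All identities between linear maps on tensor powers are proved by transposition. Over a field a
  tensor is determined by the values on it of multilinear functionals \<open>\<phi>\<close> on words
  (\<open>mem_relations_iff\<close>), and composing a linear map between tensor powers with such functionals
  transforms them into others (\<open>transpose_of\<close>). Hence two maps are equal if their transposes
  agree on words, and this is an identity between scalars. Multilinearity of the transpose is in
  turn all that is needed for a map to be well defined (\<open>tensor_lift_transpose\<close>).
\<close>

section \<open>The free vector space on words\<close>

lemma lookup_free_scale [simp]:
  "Poly_Mapping.lookup (free_scale c x) vs = c * Poly_Mapping.lookup x vs"
  unfolding free_scale_def by (simp add: Poly_Mapping.map.rep_eq when_def)

lemma keys_free_scale_subset: "Poly_Mapping.keys (free_scale c x) \<subseteq> Poly_Mapping.keys x"
  by (auto simp: in_keys_iff)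

global_interpretation free: vector_space "free_scale :: 'k::field \<Rightarrow> ('k, 'v) words \<Rightarrow> ('k, 'v) words"
  by unfold_locales (auto intro!: poly_mapping_eqI simp: lookup_add algebra_simps)

text \<open>
  The linear extension of a function on words to the free space.
\<close>

definition evaluate :: "('v list \<Rightarrow> 'k) \<Rightarrow> ('k::field, 'v) words \<Rightarrow> 'k" where
  "evaluate \<phi> x = (\<Sum>vs\<in>Poly_Mapping.keys x. Poly_Mapping.lookup x vs * \<phi> vs)"

lemma evaluate_superset:
  assumes "finite S" "Poly_Mapping.keys x \<subseteq> S"
  shows "evaluate \<phi> x = (\<Sum>vs\<in>S. Poly_Mapping.lookup x vs * \<phi> vs)"
  unfolding evaluate_def using assms by (intro sum.mono_neutral_left) (auto simp: in_keys_iff)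

lemma evaluate_add [simp]: "evaluate \<phi> (x + y) = evaluate \<phi> x + evaluate \<phi> y"
proof -
  let ?S = "Poly_Mapping.keys x \<union> Poly_Mapping.keys y"
  show ?thesis
    using Poly_Mapping.keys_add[of x y]
    by (simp add: evaluate_superset[of ?S] lookup_add distrib_right sum.distrib)
qed

lemma evaluate_free_scale [simp]: "evaluate \<phi> (free_scale c x) = c * evaluate \<phi> x"
  using keys_free_scale_subset[of c x]
  by (simp add: evaluate_superset[of "Poly_Mapping.keys x"] sum_distrib_left mult.assoc)

lemma evaluate_zero [simp]: "evaluate \<phi> 0 = 0"
  by (simp add: evaluate_def)

lemma evaluate_uminus [simp]: "evaluate \<phi> (- x) = - evaluate \<phi> x"
  using evaluate_add[of \<phi> x "- x"] by (simp del: evaluate_add add: eq_neg_iff_add_eq_0 add.commute)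

lemma evaluate_diff [simp]: "evaluate \<phi> (x - y) = evaluate \<phi> x - evaluate \<phi> y"
  using evaluate_add[of \<phi> x "- y"] by (simp del: evaluate_add)

lemma evaluate_sum [simp]: "evaluate \<phi> (\<Sum>i\<in>I. f i) = (\<Sum>i\<in>I. evaluate \<phi> (f i))"
  by (induction I rule: infinite_finite_induct) auto

lemma evaluate_single [simp]: "evaluate \<phi> (Poly_Mapping.single vs c) = c * \<phi> vs"
  by (cases "c = 0") (auto simp: evaluate_def)

lemma evaluate_word [simp]: "evaluate \<phi> (word vs) = \<phi> vs"
  by (simp add: word_def)

lemma evaluate_cong: "(\<And>vs. vs \<in> Poly_Mapping.keys x \<Longrightarrow> \<phi> vs = \<psi> vs) \<Longrightarrow> evaluate \<phi> x = evaluate \<psi> x"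
  by (simp add: evaluate_def)

lemma words_expansion:
  "x = (\<Sum>vs\<in>Poly_Mapping.keys x. free_scale (Poly_Mapping.lookup x vs) (word vs))"
  by (rule poly_mapping_eqI)
    (auto simp: lookup_sum word_def lookup_single when_def in_keys_iff if_distrib[of "(*) _"] cong: if_cong)

lemma linear_functional_eq_evaluate:
  assumes "Vector_Spaces.linear free_scale (*) f"
  shows "f x = evaluate (\<lambda>vs. f (word vs)) x"
proof -
  interpret f: Vector_Spaces.linear free_scale "(*)" f by fact
  have "f x = f (\<Sum>vs\<in>Poly_Mapping.keys x. free_scale (Poly_Mapping.lookup x vs) (word vs))"
    using words_expansion[of x] by simp
  also have "\<dots> = evaluate (\<lambda>vs. f (word vs)) x"
    by (simp add: f.sum f.scale evaluate_def)
  finally show ?thesis .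
qed

definition homogeneous :: "nat \<Rightarrow> ('k::field, 'v) words \<Rightarrow> bool" where
  "homogeneous n x \<longleftrightarrow> (\<forall>vs\<in>Poly_Mapping.keys x. length vs = n)"

lemma homogeneous_word [simp]: "length vs = n \<Longrightarrow> homogeneous n (word vs)"
  by (simp add: homogeneous_def word_def)

lemma homogeneous_zero [simp]: "homogeneous n 0"
  by (simp add: homogeneous_def)

lemma homogeneous_add [simp]: "homogeneous n x \<Longrightarrow> homogeneous n y \<Longrightarrow> homogeneous n (x + y)"
  using Poly_Mapping.keys_add[of x y] by (auto simp: homogeneous_def)

lemma homogeneous_free_scale [simp]: "homogeneous n x \<Longrightarrow> homogeneous n (free_scale c x)"
  using keys_free_scale_subset[of c x] by (auto simp: homogeneous_def)

lemma homogeneous_sum [simp]: "(\<And>i. i \<in> I \<Longrightarrow> homogeneous n (f i)) \<Longrightarrow> homogeneous n (\<Sum>i\<in>I. f i)"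
  by (induction I rule: infinite_finite_induct) auto

lemma evaluate_free_concat [simp]:
  "evaluate \<phi> (free_concat x y) = evaluate (\<lambda>us. evaluate (\<lambda>ws. \<phi> (us @ ws)) y) x"
  by (simp add: free_concat_def) (simp add: evaluate_def sum_distrib_left mult.assoc)

lemma homogeneous_free_concat [simp]:
  "homogeneous m x \<Longrightarrow> homogeneous n y \<Longrightarrow> homogeneous (m + n) (free_concat x y)"
  unfolding free_concat_def
  by (intro homogeneous_sum) (auto simp: homogeneous_def split: if_splits)

section \<open>Multilinear functionals separate tensors\<close>

context vector_space
begin

abbreviation functional :: "('b \<Rightarrow> 'a) \<Rightarrow> bool" where
  "functional \<equiv> Vector_Spaces.linear scale (*)"

lemma functional_iff:
  "functional f \<longleftrightarrow> (\<forall>v w. f (v + w) = f v + f w) \<and> (\<forall>c v. f (scale c v) = c * f v)"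
  unfolding linear_iff
  using vector_space_axioms by (auto simp: vector_space_def algebra_simps)

lemma functional_zero: "functional f \<Longrightarrow> f 0 = 0"
  using functional_iff[of f] by (metis add_cancel_left_left)

lemma functional_diff: "functional f \<Longrightarrow> f (v - w) = f v - f w"
  using functional_iff[of f] by (metis add_diff_cancel_right' diff_add_cancel)

lemma functional_intros:
  "functional (\<lambda>v. 0)"
  "functional f \<Longrightarrow> functional g \<Longrightarrow> functional (\<lambda>v. f v + g v)"
  "functional f \<Longrightarrow> functional g \<Longrightarrow> functional (\<lambda>v. f v - g v)"
  "functional f \<Longrightarrow> functional (\<lambda>v. c * f v)"
  "functional f \<Longrightarrow> functional (\<lambda>v. f v * c)"
  "(\<And>i. i \<in> I \<Longrightarrow> functional (h i)) \<Longrightarrow> functional (\<lambda>v. \<Sum>i\<in>I. h i v)"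
  by (auto simp: functional_iff algebra_simps sum.distrib sum_distrib_left)

lemma functional_compose:
  "functional f \<Longrightarrow> Vector_Spaces.linear scale scale h \<Longrightarrow> functional (\<lambda>v. f (h v))"
  by (auto simp: functional_iff linear_iff)

definition multilinear :: "('b list \<Rightarrow> 'a) \<Rightarrow> bool" where
  "multilinear \<phi> \<longleftrightarrow> (\<forall>us ws. functional (\<lambda>v. \<phi> (us @ v # ws)))"

lemma multilinearD: "multilinear \<phi> \<Longrightarrow> functional (\<lambda>v. \<phi> (us @ v # ws))"
  by (simp add: multilinear_def)

lemma multilinear_hd: "multilinear \<phi> \<Longrightarrow> functional (\<lambda>v. \<phi> (v # ws))"
  using multilinearD[of \<phi> "[]"] by simp

lemma multilinear_append1: "multilinear \<phi> \<Longrightarrow> multilinear (\<lambda>us. \<phi> (us @ ws))"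
  by (simp add: multilinear_def)

lemma multilinear_append2: "multilinear \<phi> \<Longrightarrow> multilinear (\<lambda>ws. \<phi> (us @ ws))"
  using multilinear_def[of \<phi>] by (simp add: multilinear_def flip: append_assoc)

lemma multilinear_Cons: "multilinear \<phi> \<Longrightarrow> multilinear (\<lambda>ws. \<phi> (v # ws))"
  using multilinear_append2[of \<phi> "[v]"] by simp

lemma multilinear_intros:
  "multilinear (\<lambda>vs. 0)"
  "multilinear \<phi> \<Longrightarrow> multilinear \<psi> \<Longrightarrow> multilinear (\<lambda>v. \<phi> v + \<psi> v)"
  "multilinear \<phi> \<Longrightarrow> multilinear \<psi> \<Longrightarrow> multilinear (\<lambda>v. \<phi> v - \<psi> v)"
  "multilinear \<phi> \<Longrightarrow> multilinear (\<lambda>v. c * \<phi> v)"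
  "(\<And>i. i \<in> I \<Longrightarrow> multilinear (h i)) \<Longrightarrow> multilinear (\<lambda>v. \<Sum>i\<in>I. h i v)"
  by (auto simp: multilinear_def intro: functional_intros)

lemma multilinear_list_update:
  assumes "multilinear \<phi>" "i < length vs"
  shows "functional (\<lambda>v. \<phi> (vs[i := v]))"
  using multilinearD[OF assms(1)] assms(2) by (simp add: upd_conv_take_nth_drop)

text \<open>
  Over a field, a vector outside a subspace is detected by a linear functional vanishing on that
  subspace. A linear functional on the free space is determined by its values on words, and it
  kills the multilinearity relations exactly if these values form a multilinear functional.
\<close>

lemma mem_relations_iff:
  "x \<in> multilinear_relations scale \<longleftrightarrow> (\<forall>\<phi>. multilinear \<phi> \<longrightarrow> evaluate \<phi> x = 0)"
proof
  assume x: "x \<in> multilinear_relations scale"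
  show "\<forall>\<phi>. multilinear \<phi> \<longrightarrow> evaluate \<phi> x = 0"
  proof (intro allI impI)
    fix \<phi> assume \<phi>: "multilinear \<phi>"
    have add: "\<phi> (us @ (v + w) # ws) = \<phi> (us @ v # ws) + \<phi> (us @ w # ws)"
      and sc: "\<phi> (us @ scale c v # ws) = c * \<phi> (us @ v # ws)" for us v w ws c
      using multilinearD[OF \<phi>, of us ws] by (simp_all add: functional_iff)
    show "evaluate \<phi> x = 0"
      using x unfolding multilinear_relations_def
      by (induction rule: free.span_induct_alt) (auto simp: add sc)
  qed
next
  let ?R = "multilinear_relations scale"
  assume *: "\<forall>\<phi>. multilinear \<phi> \<longrightarrow> evaluate \<phi> x = 0"
  show "x \<in> ?R"
  proof (rule ccontr)
    assume x: "x \<notin> ?R"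
    \<comment> \<open>Extend a basis \<open>B\<close> of the relations by \<open>x\<close>; the functional that is 1 at \<open>x\<close> and 0 on \<open>B\<close> separates.\<close>
    interpret k: vector_space "(*) :: 'a \<Rightarrow> 'a \<Rightarrow> 'a"
      by unfold_locales (auto simp: algebra_simps)
    interpret fk: vector_space_pair "free_scale :: 'a \<Rightarrow> ('a, 'b) words \<Rightarrow> ('a, 'b) words" "(*) :: 'a \<Rightarrow> 'a \<Rightarrow> 'a" ..
    obtain B where B: "B \<subseteq> ?R" "free.independent B" "?R \<subseteq> free.span B"
      using free.maximal_independent_subset by blast
    have "free.span B \<subseteq> ?R"
      using B(1) unfolding multilinear_relations_def by (meson free.span_minimal free.subspace_span)
    then have "x \<notin> free.span B" using x by blast
    then have ind: "free.independent (insert x B)"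
      using B(2) by (rule free.independent_insertI)
    obtain f where f: "Vector_Spaces.linear free_scale (*) f"
      "\<And>y. y \<in> insert x B \<Longrightarrow> f y = (if y = x then 1 else 0)"
      using fk.linear_independent_extend[OF ind, of "\<lambda>y. if y = x then 1 else 0"] by blast
    interpret f: Vector_Spaces.linear free_scale "(*)" f by (rule f(1))
    have fB: "f y = 0" if "y \<in> B" for y
      using f(2)[of y] that x B(1) by auto
    have fR: "f y = 0" if "y \<in> ?R" for y
      using that B(3) fB f.eq_0_on_span by blast
    have rel: "r \<in> {word (us @ [v + w] @ ws) - word (us @ [v] @ ws) - word (us @ [w] @ ws) | us v w ws. True}
      \<union> {word (us @ [scale c v] @ ws) - free_scale c (word (us @ [v] @ ws)) | us c v ws. True}
      \<Longrightarrow> f r = 0" for r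
      by (rule fR) (auto simp: multilinear_relations_def intro!: free.span_base)
    have "multilinear (\<lambda>vs. f (word vs))"
      unfolding multilinear_def functional_iff
    proof (intro allI conjI)
      fix us ws v w c
      show "f (word (us @ (v + w) # ws)) = f (word (us @ v # ws)) + f (word (us @ w # ws))"
      proof -
        have "f (word (us @ [v + w] @ ws) - word (us @ [v] @ ws) - word (us @ [w] @ ws)) = 0"
          by (rule rel) blast
        then show ?thesis by (simp add: f.diff f.add algebra_simps)
      qed
      show "f (word (us @ scale c v # ws)) = c * f (word (us @ v # ws))"
      proof -
        have "f (word (us @ [scale c v] @ ws) - free_scale c (word (us @ [v] @ ws))) = 0"
          by (rule rel) blast
        then show ?thesis by (simp add: f.diff f.scale)
      qed
    qed
    then have "f x = 0"
      using * linear_functional_eq_evaluate[OF f(1), of x] by simp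
    then show False using f(2)[of x] by simp
  qed
qed

lemma relations_closed:
  "0 \<in> multilinear_relations scale"
  "x \<in> multilinear_relations scale \<Longrightarrow> y \<in> multilinear_relations scale
    \<Longrightarrow> x + y \<in> multilinear_relations scale"
  by (auto simp: mem_relations_iff)

lemma mem_tensor_class_iff:
  "y \<in> tensor_class scale x \<longleftrightarrow> (\<forall>\<phi>. multilinear \<phi> \<longrightarrow> evaluate \<phi> y = evaluate \<phi> x)"
proof -
  have "y \<in> tensor_class scale x \<longleftrightarrow> y - x \<in> multilinear_relations scale"
    unfolding tensor_class_def elt_set_plus_def by (auto intro!: bexI[of _ "y - x"])
  then show ?thesis by (simp add: mem_relations_iff)
qed

lemma tensor_class_eq_iff:
  "tensor_class scale x = tensor_class scale y
    \<longleftrightarrow> (\<forall>\<phi>. multilinear \<phi> \<longrightarrow> evaluate \<phi> x = evaluate \<phi> y)"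
proof
  assume "tensor_class scale x = tensor_class scale y"
  moreover have "x \<in> tensor_class scale x" by (simp add: mem_tensor_class_iff)
  ultimately have "x \<in> tensor_class scale y" by simp
  then show "\<forall>\<phi>. multilinear \<phi> \<longrightarrow> evaluate \<phi> x = evaluate \<phi> y"
    by (simp add: mem_tensor_class_iff)
qed (simp add: set_eq_iff mem_tensor_class_iff)

text \<open>
  Multilinear functionals are constant on cosets, so for them the choice of a representative is
  immaterial.
\<close>

definition pairing :: "('b list \<Rightarrow> 'a) \<Rightarrow> ('a, 'b) words set \<Rightarrow> 'a" where
  "pairing \<phi> A = evaluate \<phi> (SOME x. x \<in> A)"

lemma pairing_class [simp]: "multilinear \<phi> \<Longrightarrow> pairing \<phi> (tensor_class scale x) = evaluate \<phi> x"
  unfolding pairing_def using someI[of "\<lambda>y. y \<in> tensor_class scale x" x]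
  by (simp add: mem_tensor_class_iff)

lemma pairing_pure [simp]: "multilinear \<phi> \<Longrightarrow> pairing \<phi> (pure_tensor scale vs) = \<phi> vs"
  by (simp add: pure_tensor_def)

lemma tensor_power_iff:
  "A \<in> tensor_power scale n \<longleftrightarrow> (\<exists>x. homogeneous n x \<and> A = tensor_class scale x)"
  by (auto simp: tensor_power_def homogeneous_def)

lemma tensor_class_in_power [simp]: "homogeneous n x \<Longrightarrow> tensor_class scale x \<in> tensor_power scale n"
  by (auto simp: tensor_power_iff)

lemma pure_in_power [simp]: "length vs = n \<Longrightarrow> pure_tensor scale vs \<in> tensor_power scale n"
  by (simp add: pure_tensor_def)

lemma tensor_eqI:
  assumes "A \<in> tensor_power scale m" "B \<in> tensor_power scale n"
    "\<And>\<phi>. multilinear \<phi> \<Longrightarrow> pairing \<phi> A = pairing \<phi> B"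
  shows "A = B"
proof -
  obtain x y where "A = tensor_class scale x" "B = tensor_class scale y"
    using assms(1,2) by (auto simp: tensor_power_iff)
  then show ?thesis using assms(3) by (simp add: tensor_class_eq_iff)
qed

lemma tensor_class_add:
  "tensor_class scale x + tensor_class scale y = tensor_class scale (x + y)"
proof -
  have "multilinear_relations scale + multilinear_relations scale = multilinear_relations scale"
  proof (intro equalityI subsetI)
    fix z assume "z \<in> multilinear_relations scale"
    then show "z \<in> multilinear_relations scale + multilinear_relations scale"
      using set_plus_intro[OF relations_closed(1)] by fastforce
  qed (auto elim!: set_plus_elim intro: relations_closed(2))
  then show ?thesis by (simp add: tensor_class_def set_plus_rearrange)
qed

lemma tensor_scale_class: "tensor_scale scale c (tensor_class scale x) = tensor_class scale (free_scale c x)"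
proof -
  have "z \<in> tensor_class scale (free_scale c x)"
    if "z \<in> free_scale c ` tensor_class scale x + multilinear_relations scale" for z
    using that by (auto simp: set_plus_def mem_tensor_class_iff mem_relations_iff)
  moreover have "z \<in> free_scale c ` tensor_class scale x + multilinear_relations scale"
    if "z \<in> tensor_class scale (free_scale c x)" for z
  proof -
    have "z = free_scale c x + (z - free_scale c x)" by simp
    moreover have "z - free_scale c x \<in> multilinear_relations scale"
      using that by (simp add: mem_tensor_class_iff mem_relations_iff)
    moreover have "x \<in> tensor_class scale x" by (simp add: mem_tensor_class_iff)
    ultimately show ?thesis by (metis image_eqI set_plus_intro)
  qed
  ultimately show ?thesis unfolding tensor_scale_def by blast
qed

lemma tensor_sum_class:
  assumes "finite I"
  shows "tensor_sum scale (\<lambda>i. tensor_class scale (f i)) I = tensor_class scale (\<Sum>i\<in>I. f i)"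
  using assms
proof (induction I rule: finite_induct)
  case empty
  then show ?case by (simp add: tensor_sum_def tensor_class_def set_plus_def)
next
  case (insert i I)
  then show ?case
    by (simp add: tensor_sum_def add.assoc tensor_class_add)
qed

text \<open>
  The relations form a two-sided ideal for concatenation, because fixing a prefix or a suffix of
  its argument leaves a functional multilinear.
\<close>

lemma tensor_prod_class:
  "tensor_prod scale (tensor_class scale x) (tensor_class scale y) = tensor_class scale (free_concat x y)"
proof -
  have cong: "evaluate \<phi> (free_concat x' y') = evaluate \<phi> (free_concat x y)"
    if "x' \<in> tensor_class scale x" "y' \<in> tensor_class scale y" "multilinear \<phi>" for x' y' \<phi>
  proof -
    have y: "evaluate (\<lambda>ws. \<phi> (us @ ws)) y' = evaluate (\<lambda>ws. \<phi> (us @ ws)) y" for us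
      using that multilinear_append2[of \<phi> us] by (simp add: mem_tensor_class_iff)
    have "multilinear (\<lambda>us. evaluate (\<lambda>ws. \<phi> (us @ ws)) y)"
      unfolding evaluate_def using that(3)
      by (intro multilinear_intros multilinear_append1)
    then show ?thesis using that(1) by (simp add: y mem_tensor_class_iff)
  qed
  have "z \<in> tensor_class scale (free_concat x y)"
    if "z \<in> tensor_prod scale (tensor_class scale x) (tensor_class scale y)" for z
    using that cong unfolding tensor_prod_def set_plus_def mem_tensor_class_iff[of z]
    by (auto simp: mem_relations_iff simp del: evaluate_free_concat)
  moreover have "z \<in> tensor_prod scale (tensor_class scale x) (tensor_class scale y)"
    if "z \<in> tensor_class scale (free_concat x y)" for z
  proof -
    have "z = free_concat x y + (z - free_concat x y)" by simp
    moreover have "z - free_concat x y \<in> multilinear_relations scale"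
      using that by (simp add: mem_tensor_class_iff mem_relations_iff)
    moreover have "x \<in> tensor_class scale x" "y \<in> tensor_class scale y"
      by (simp_all add: mem_tensor_class_iff)
    ultimately show ?thesis unfolding tensor_prod_def
      by (smt (verit, best) mem_Collect_eq set_plus_intro)
  qed
  ultimately show ?thesis by blast
qed

lemma tensor_zero_class: "tensor_zero scale = tensor_class scale 0"
  by (simp add: tensor_zero_def)

lemma tensor_power_closed [simp]:
  "A \<in> tensor_power scale n \<Longrightarrow> B \<in> tensor_power scale n \<Longrightarrow> A + B \<in> tensor_power scale n"
  "A \<in> tensor_power scale n \<Longrightarrow> tensor_scale scale c A \<in> tensor_power scale n"
  "tensor_zero scale \<in> tensor_power scale n"
  "A \<in> tensor_power scale m \<Longrightarrow> B \<in> tensor_power scale n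
    \<Longrightarrow> tensor_prod scale A B \<in> tensor_power scale (m + n)"
  by (auto simp: tensor_power_iff tensor_class_add tensor_scale_class tensor_zero_class
      tensor_prod_class; metis homogeneous_add homogeneous_free_scale homogeneous_zero
      homogeneous_free_concat)+

lemma pairing_add [simp]:
  "multilinear \<phi> \<Longrightarrow> A \<in> tensor_power scale m \<Longrightarrow> B \<in> tensor_power scale n
    \<Longrightarrow> pairing \<phi> (A + B) = pairing \<phi> A + pairing \<phi> B"
  by (auto simp: tensor_power_iff tensor_class_add)

lemma pairing_scale [simp]:
  "multilinear \<phi> \<Longrightarrow> A \<in> tensor_power scale n \<Longrightarrow> pairing \<phi> (tensor_scale scale c A) = c * pairing \<phi> A"
  by (auto simp: tensor_power_iff tensor_scale_class)

lemma pairing_zero [simp]: "multilinear \<phi> \<Longrightarrow> pairing \<phi> (tensor_zero scale) = 0"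
  by (simp add: tensor_zero_class)

lemma pairing_pure_prod [simp]:
  "multilinear \<phi> \<Longrightarrow> B \<in> tensor_power scale n
    \<Longrightarrow> pairing \<phi> (tensor_prod scale (pure_tensor scale us) B) = pairing (\<lambda>ws. \<phi> (us @ ws)) B"
  by (auto simp: tensor_power_iff pure_tensor_def tensor_prod_class multilinear_append2)

lemma pairing_prod_pure [simp]:
  "multilinear \<phi> \<Longrightarrow> A \<in> tensor_power scale m
    \<Longrightarrow> pairing \<phi> (tensor_prod scale A (pure_tensor scale ws)) = pairing (\<lambda>us. \<phi> (us @ ws)) A"
  by (auto simp: tensor_power_iff pure_tensor_def tensor_prod_class multilinear_append1)

lemma tensor_sum_power:
  assumes "finite I" "\<And>i. i \<in> I \<Longrightarrow> f i \<in> tensor_power scale n"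
  shows "tensor_sum scale f I \<in> tensor_power scale n"
    and "multilinear \<phi> \<Longrightarrow> pairing \<phi> (tensor_sum scale f I) = (\<Sum>i\<in>I. pairing \<phi> (f i))"
proof -
  obtain x where x: "\<And>i. i \<in> I \<Longrightarrow> homogeneous n (x i) \<and> f i = tensor_class scale (x i)"
    using assms(2) unfolding tensor_power_iff by metis
  then have "tensor_sum scale f I = tensor_class scale (\<Sum>i\<in>I. x i)"
    using tensor_sum_class[OF assms(1), of x] by (simp add: tensor_sum_def)
  then show "tensor_sum scale f I \<in> tensor_power scale n"
    and "multilinear \<phi> \<Longrightarrow> pairing \<phi> (tensor_sum scale f I) = (\<Sum>i\<in>I. pairing \<phi> (f i))"
    using x by simp_all
qed

lemma pairing_cong:
  assumes "multilinear \<phi>" "multilinear \<psi>" "A \<in> tensor_power scale n"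
    "\<And>vs. length vs = n \<Longrightarrow> \<phi> vs = \<psi> vs"
  shows "pairing \<phi> A = pairing \<psi> A"
proof -
  obtain x where "homogeneous n x" "A = tensor_class scale x"
    using assms(3) by (auto simp: tensor_power_iff)
  then show ?thesis
    using assms by (simp add: homogeneous_def evaluate_cong[of x \<phi> \<psi>])
qed

section \<open>Linear maps between tensor powers and their transposes\<close>

text \<open>
  The transpose of a linear map between fixed tensor powers acts on multilinear functionals on
  words of arbitrary length. This allows operators such as the faces below to be defined once for
  all tensor powers; only their values on words of length \<open>m\<close> matter for maps with source
  \<open>V\<^sup>\<otimes>\<^sup>m\<close>. Composition reverses the order of the transposes.
\<close>

definition transpose_of ::
    "nat \<Rightarrow> nat \<Rightarrow> (('a, 'b) words set \<Rightarrow> ('a, 'b) words set) \<Rightarrow> (('b list \<Rightarrow> 'a) \<Rightarrow> 'b list \<Rightarrow> 'a) \<Rightarrow> bool" where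
  "transpose_of m n f F \<longleftrightarrow> (\<forall>A\<in>tensor_power scale m. f A \<in> tensor_power scale n) \<and>
     (\<forall>\<phi>. multilinear \<phi> \<longrightarrow> multilinear (F \<phi>) \<and>
        (\<forall>A\<in>tensor_power scale m. pairing \<phi> (f A) = pairing (F \<phi>) A))"

lemma transpose_ofD:
  assumes "transpose_of m n f F"
  shows "A \<in> tensor_power scale m \<Longrightarrow> f A \<in> tensor_power scale n"
    and "multilinear \<phi> \<Longrightarrow> multilinear (F \<phi>)"
    and "multilinear \<phi> \<Longrightarrow> A \<in> tensor_power scale m \<Longrightarrow> pairing \<phi> (f A) = pairing (F \<phi>) A"
  using assms by (auto simp: transpose_of_def)

lemma transpose_compose:
  "transpose_of m n f F \<Longrightarrow> transpose_of n p g G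
    \<Longrightarrow> transpose_of m p (\<lambda>A. g (f A)) (\<lambda>\<phi>. F (G \<phi>))"
  by (simp add: transpose_of_def)

lemma transpose_id: "transpose_of n n (\<lambda>A. A) (\<lambda>\<phi>. \<phi>)"
  by (simp add: transpose_of_def)

lemma transpose_cong_map:
  "transpose_of m n f F \<Longrightarrow> (\<And>A. A \<in> tensor_power scale m \<Longrightarrow> g A = f A) \<Longrightarrow> transpose_of m n g F"
  by (auto simp: transpose_of_def)

lemma transpose_cong:
  assumes "transpose_of m n f F" "\<And>\<phi>. multilinear \<phi> \<Longrightarrow> multilinear (G \<phi>)"
    "\<And>\<phi> vs. multilinear \<phi> \<Longrightarrow> length vs = m \<Longrightarrow> F \<phi> vs = G \<phi> vs"
  shows "transpose_of m n f G"
  using assms pairing_cong[of "F _" "G _" _ m] by (simp add: transpose_of_def)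

lemma transpose_sum:
  assumes "finite I" "\<And>i. i \<in> I \<Longrightarrow> transpose_of m n (f i) (F i)"
  shows "transpose_of m n (\<lambda>A. tensor_sum scale (\<lambda>i. tensor_scale scale (c i) (f i A)) I)
    (\<lambda>\<phi> vs. \<Sum>i\<in>I. c i * F i \<phi> vs)"
  unfolding transpose_of_def
proof (intro conjI ballI allI impI)
  fix A assume A: "A \<in> tensor_power scale m"
  have f: "f i A \<in> tensor_power scale n" if "i \<in> I" for i
    using transpose_ofD(1)[OF assms(2)[OF that] A] .
  show "tensor_sum scale (\<lambda>i. tensor_scale scale (c i) (f i A)) I \<in> tensor_power scale n"
    using assms(1) f by (intro tensor_sum_power) auto
  fix \<phi> assume \<phi>: "multilinear \<phi>"
  obtain x where x: "A = tensor_class scale x" using A by (auto simp: tensor_power_iff)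
  have F: "multilinear (F i \<phi>)" "pairing \<phi> (f i A) = evaluate (F i \<phi>) x" if "i \<in> I" for i
    using transpose_ofD(2,3)[OF assms(2)[OF that] \<phi>] A x by auto
  have "pairing \<phi> (tensor_sum scale (\<lambda>i. tensor_scale scale (c i) (f i A)) I) =
    (\<Sum>i\<in>I. c i * evaluate (F i \<phi>) x)"
    using assms(1) f \<phi> by (subst tensor_sum_power(2)[where n = n]) (auto simp: pairing_scale[OF _ f] F)
  also have "\<dots> = evaluate (\<lambda>vs. \<Sum>i\<in>I. c i * F i \<phi> vs) x"
    unfolding evaluate_def sum_distrib_left by (subst sum.swap) (simp add: mult_ac)
  also have "\<dots> = pairing (\<lambda>vs. \<Sum>i\<in>I. c i * F i \<phi> vs) A"
    unfolding x using F(1) by (intro pairing_class[symmetric] multilinear_intros)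
  finally show "pairing \<phi> (tensor_sum scale (\<lambda>i. tensor_scale scale (c i) (f i A)) I) =
    pairing (\<lambda>vs. \<Sum>i\<in>I. c i * F i \<phi> vs) A" .
next
  fix \<phi> assume "multilinear \<phi>"
  then show "multilinear (\<lambda>vs. \<Sum>i\<in>I. c i * F i \<phi> vs)"
    using transpose_ofD(2)[OF assms(2)] by (intro multilinear_intros)
qed

text \<open>
  Multilinear functionals separate tensors, and on \<open>V\<^sup>\<otimes>\<^sup>m\<close> they depend only on their values on words
  of length \<open>m\<close>. All identities between maps of tensor powers below are reduced in this way to
  identities of scalars.
\<close>

lemma transpose_eqI:
  assumes "transpose_of m n f F" "transpose_of m n g G" "A \<in> tensor_power scale m"
    "\<And>\<phi> vs. multilinear \<phi> \<Longrightarrow> length vs = m \<Longrightarrow> F \<phi> vs = G \<phi> vs"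
  shows "f A = g A"
proof (rule tensor_eqI)
  fix \<phi> assume "multilinear \<phi>"
  then show "pairing \<phi> (f A) = pairing \<phi> (g A)"
    using assms pairing_cong[of "F \<phi>" "G \<phi>" A m] by (simp add: transpose_of_def)
qed (use assms in \<open>auto simp: transpose_of_def\<close>)

lemma transpose_pure_eqI:
  assumes "transpose_of m n f F" "length vs = m" "B \<in> tensor_power scale n"
    "\<And>\<phi>. multilinear \<phi> \<Longrightarrow> F \<phi> vs = pairing \<phi> B"
  shows "f (pure_tensor scale vs) = B"
  using assms transpose_ofD[OF assms(1)] by (intro tensor_eqI[of _ n _ n]) simp_all

lemma transpose_tensor_hom:
  assumes "transpose_of m n f F"
  shows "restrict f (tensor_power scale m) \<in> tensor_hom scale m n"
proof -
  note f = transpose_ofD[OF assms]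
  have "f (A + B) = f A + f B" if "A \<in> tensor_power scale m" "B \<in> tensor_power scale m" for A B
    using that f(2) by (intro tensor_eqI[of _ n _ n])
      (simp_all add: f(1) f(3) pairing_add[where m = m and n = m] pairing_add[where m = n and n = n])
  moreover have "f (tensor_scale scale c A) = tensor_scale scale c (f A)"
    if "A \<in> tensor_power scale m" for A c
    using that f(2) by (intro tensor_eqI[of _ n _ n])
      (simp_all add: f(1) f(3) pairing_scale[where n = m] pairing_scale[where n = n])
  ultimately show ?thesis
    using transpose_ofD(1)[OF assms] by (auto simp: tensor_hom_def)
qed

text \<open>
  A homogeneous representative is a combination of words, so linearity expresses the value of a
  homomorphism by its values on pure tensors. This gives the uniqueness of linear extensions.
\<close>

lemma tensor_hom_class:
  assumes f: "f \<in> tensor_hom scale m n" and x: "homogeneous m x"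
  shows "f (tensor_class scale x) = tensor_sum scale
    (\<lambda>vs. tensor_scale scale (Poly_Mapping.lookup x vs) (f (pure_tensor scale vs))) (Poly_Mapping.keys x)"
proof -
  have "f (tensor_class scale (\<Sum>vs\<in>S. free_scale (Poly_Mapping.lookup x vs) (word vs))) =
    tensor_sum scale (\<lambda>vs. tensor_scale scale (Poly_Mapping.lookup x vs) (f (pure_tensor scale vs))) S"
    if "finite S" "S \<subseteq> Poly_Mapping.keys x" for S
    using that
  proof (induction S rule: finite_induct)
    case empty
    have "tensor_scale scale 0 (tensor_zero scale) = tensor_zero scale"
      by (simp add: tensor_zero_class tensor_scale_class)
    moreover have "f (tensor_scale scale 0 (tensor_zero scale)) = tensor_scale scale 0 (f (tensor_zero scale))"
      using f by (simp add: tensor_hom_def)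
    moreover have "f (tensor_zero scale) \<in> tensor_power scale n"
      using f by (auto simp: tensor_hom_def)
    then have "tensor_scale scale 0 (f (tensor_zero scale)) = tensor_zero scale"
      by (intro tensor_eqI[of _ n _ n]) auto
    ultimately show ?case
      by (simp add: tensor_sum_def tensor_zero_def) (simp add: tensor_class_def)
  next
    case (insert vs S)
    let ?y = "\<lambda>vs. free_scale (Poly_Mapping.lookup x vs) (word vs)"
    have len: "length ws = m" if "ws \<in> insert vs S" for ws
      using insert.prems that x by (auto simp: homogeneous_def)
    have "f (tensor_class scale (\<Sum>vs\<in>insert vs S. ?y vs)) = f (tensor_class scale (?y vs) + tensor_class scale (\<Sum>vs\<in>S. ?y vs))"
      using insert by (simp add: tensor_class_add)
    also have "\<dots> = f (tensor_class scale (?y vs)) + f (tensor_class scale (\<Sum>vs\<in>S. ?y vs))"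
      using f len by (simp add: tensor_hom_def)
    also have "f (tensor_class scale (?y vs)) = tensor_scale scale (Poly_Mapping.lookup x vs) (f (pure_tensor scale vs))"
      using f len[of vs] by (simp add: tensor_hom_def pure_tensor_def flip: tensor_scale_class)
    finally show ?case
      using insert by (simp add: tensor_sum_def add.assoc)
  qed
  from this[OF finite_keys order_refl] show ?thesis
    using arg_cong[OF words_expansion, of "\<lambda>y. f (tensor_class scale y)" x] by simp
qed

lemma tensor_hom_eqI:
  assumes "f \<in> tensor_hom scale m n" "g \<in> tensor_hom scale m n"
    "\<And>vs. length vs = m \<Longrightarrow> f (pure_tensor scale vs) = g (pure_tensor scale vs)"
  shows "f = g"
proof
  fix A
  show "f A = g A"
  proof (cases "A \<in> tensor_power scale m")
    case True
    then obtain x where x: "homogeneous m x" "A = tensor_class scale x"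
      by (auto simp: tensor_power_iff)
    have "(\<Sum>vs\<in>Poly_Mapping.keys x. tensor_scale scale (Poly_Mapping.lookup x vs) (f (pure_tensor scale vs))) =
      (\<Sum>vs\<in>Poly_Mapping.keys x. tensor_scale scale (Poly_Mapping.lookup x vs) (g (pure_tensor scale vs)))"
      using x(1) assms(3) by (intro sum.cong) (auto simp: homogeneous_def)
    then show ?thesis
      using x assms(1,2) by (simp add: tensor_hom_class tensor_sum_def)
  next
    case False
    then show ?thesis using assms(1,2) by (auto simp: tensor_hom_def PiE_def extensional_def)
  qed
qed

text \<open>
  The universal property of the tensor power, in transposed form: a prescription on words extends
  linearly if composing it with multilinear functionals gives multilinear functionals, since then
  its extension to the free space sends relations to tensors on which all such functionals vanish.
\<close>

lemma tensor_lift_transpose: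
  assumes g: "\<And>vs. length vs = m \<Longrightarrow> g vs \<in> tensor_power scale n"
    and F: "\<And>\<phi>. multilinear \<phi> \<Longrightarrow> multilinear (F \<phi>)"
    and gF: "\<And>\<phi> vs. multilinear \<phi> \<Longrightarrow> length vs = m \<Longrightarrow> pairing \<phi> (g vs) = F \<phi> vs"
  shows "tensor_lift scale m n g \<in> tensor_hom scale m n"
    and "length vs = m \<Longrightarrow> tensor_lift scale m n g (pure_tensor scale vs) = g vs"
    and "transpose_of m n (tensor_lift scale m n g) F"
proof -
  obtain G where G: "\<And>vs. length vs = m \<Longrightarrow> homogeneous n (G vs) \<and> g vs = tensor_class scale (G vs)"
    using g unfolding tensor_power_iff by metis
  have "\<forall>A\<in>tensor_power scale m. \<exists>x. homogeneous m x \<and> A = tensor_class scale x"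
    by (simp add: tensor_power_iff)
  then obtain r where r: "\<And>A. A \<in> tensor_power scale m \<Longrightarrow> homogeneous m (r A) \<and> A = tensor_class scale (r A)"
    by metis
  define f where "f A = tensor_class scale
    (\<Sum>vs\<in>Poly_Mapping.keys (r A). free_scale (Poly_Mapping.lookup (r A) vs) (G vs))" for A
  have f: "transpose_of m n f F"
    unfolding transpose_of_def
  proof (intro conjI ballI allI impI F)
    fix A assume A: "A \<in> tensor_power scale m"
    show "f A \<in> tensor_power scale n"
      unfolding f_def using r[OF A] G by (intro tensor_class_in_power homogeneous_sum homogeneous_free_scale)
        (auto simp: homogeneous_def)
    fix \<phi> assume \<phi>: "multilinear \<phi>"
    have "evaluate \<phi> (G vs) = F \<phi> vs" if "length vs = m" for vs
      using gF[OF \<phi> that] G[OF that] \<phi> by simp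
    then have "pairing \<phi> (f A) = evaluate (F \<phi>) (r A)"
      using r[OF A] \<phi> by (simp add: f_def) (simp add: evaluate_def homogeneous_def)
    also have "\<dots> = pairing (F \<phi>) A"
      using r[OF A] F[OF \<phi>] by (metis pairing_class)
    finally show "pairing \<phi> (f A) = pairing (F \<phi>) A" .
  qed
  have pure: "f (pure_tensor scale vs) = g vs" if "length vs = m" for vs
    using that gF g by (intro transpose_pure_eqI[OF f]) auto
  define h where "h = restrict f (tensor_power scale m)"
  have h: "h \<in> tensor_hom scale m n" "\<forall>vs. length vs = m \<longrightarrow> h (pure_tensor scale vs) = g vs"
    using transpose_tensor_hom[OF f] pure by (auto simp: h_def)
  have "tensor_lift scale m n g = h"
    unfolding tensor_lift_def using h by (intro the_equality) (auto intro: tensor_hom_eqI)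
  then show "tensor_lift scale m n g \<in> tensor_hom scale m n"
    and "length vs = m \<Longrightarrow> tensor_lift scale m n g (pure_tensor scale vs) = g vs"
    and "transpose_of m n (tensor_lift scale m n g) F"
    using h by (auto intro!: transpose_cong_map[OF f] simp: h_def)
qed

lemma list_slot:
  assumes "1 \<le> j" "j \<le> length vs"
  obtains us v ws where "vs = us @ v # ws" "j = Suc (length us)"
  using that[of "take (j - 1) vs" "vs ! (j - 1)" "drop j vs"] assms id_take_nth_drop[of "j - 1" vs]
  by simp

lemma list_two_slots:
  assumes "1 \<le> i" "i < j" "j \<le> length vs"
  obtains us u ms v ws where "vs = us @ u # ms @ v # ws"
    "i = Suc (length us)" "j = Suc (Suc (length us + length ms))"
proof -
  have "i \<le> length vs" using assms by simp
  from list_slot[OF assms(1) this]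
  obtain us u rest where 1: "vs = us @ u # rest" "i = Suc (length us)" .
  have "1 \<le> j - i" "j - i \<le> length rest" using assms 1 by auto
  from list_slot[OF this]
  obtain ms v ws where "rest = ms @ v # ws" "j - i = Suc (length ms)" .
  then show ?thesis using that 1 assms by simp
qed

lemma multilinear_case_list:
  assumes "\<And>ws. functional (\<lambda>v. K v ws)" "\<And>v. multilinear (K v)"
  shows "multilinear (case_list 0 K)"
  unfolding multilinear_def
proof (intro allI)
  fix us ws
  show "functional (\<lambda>v. case_list 0 K (us @ v # ws))"
    using assms by (cases us) (auto simp: multilinear_def)
qed

text \<open>
  The transposes of interest single out the letter in position \<open>j\<close>, counted from 1, and treat the
  letters before and after it separately. Extending them by zero to words without such a letter
  keeps them multilinear on words of every length.
\<close>

definition at_slot :: "nat \<Rightarrow> ('b list \<Rightarrow> 'b \<Rightarrow> 'b list \<Rightarrow> 'a) \<Rightarrow> 'b list \<Rightarrow> 'a" where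
  "at_slot j K vs = (if 1 \<le> j \<and> j \<le> length vs then K (take (j - 1) vs) (vs ! (j - 1)) (drop j vs) else 0)"

lemma at_slot_at: "j = Suc (length us) \<Longrightarrow> at_slot j K (us @ v # ws) = K us v ws"
  by (simp add: at_slot_def)

text \<open>
  Iterated applications produce words in which the letter in question is preceded by several
  blocks; these are the shapes in which such words appear after reassociating to the right.
\<close>

lemmas at_slot_eqs =
  at_slot_at
  at_slot_at[of _ "us @ [u]" for us u, simplified]
  at_slot_at[of _ "us @ ms" for us ms, simplified]
  at_slot_at[of _ "us @ u # ms" for us u ms, simplified]
  at_slot_at[of _ "us @ u # u' # ms" for us u u' ms, simplified]

lemma multilinear_at_slot:
  assumes "\<And>v ws. multilinear (\<lambda>us. K us v ws)" "\<And>us ws. functional (\<lambda>v. K us v ws)"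
    "\<And>us v. multilinear (K us v)"
  shows "multilinear (at_slot j K)"
  unfolding multilinear_def
proof (intro allI)
  fix us ws :: "'b list"
  consider "1 \<le> j" "j \<le> length us" | "j = Suc (length us)"
    | "Suc (length us) < j" "j \<le> Suc (length us + length ws)"
    | "j = 0 \<or> j > Suc (length us + length ws)" by linarith
  then show "functional (\<lambda>x. at_slot j K (us @ x # ws))"
  proof cases
    case 1
    then obtain us1 v us2 where "us = us1 @ v # us2" "j = Suc (length us1)" by (rule list_slot)
    then show ?thesis using multilinearD[OF assms(3)] by (simp add: at_slot_eqs)
  next
    case 2
    then show ?thesis using assms(2) by (simp add: at_slot_eqs)
  next
    case 3
    then have "1 \<le> j - Suc (length us)" "j - Suc (length us) \<le> length ws" by auto
    from list_slot[OF this]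
    obtain ws1 v ws2 where "ws = ws1 @ v # ws2" "j - Suc (length us) = Suc (length ws1)" .
    then show ?thesis using 3 multilinearD[OF assms(1)] by (simp add: at_slot_eqs)
  next
    case 4
    then show ?thesis by (auto simp: at_slot_def functional_iff)
  qed
qed

end

section \<open>The braiding of a unital Leibniz algebra\<close>

context unital_leibniz
begin

abbreviation \<sigma> :: "('k, 'v) words set \<Rightarrow> ('k, 'v) words set" where
  "\<sigma> \<equiv> leibniz_braiding scale bracket one"

lemma bracket_zero: "bracket 0 v = 0" "bracket v 0 = 0"
  using linear_left[of v] linear_right[of v] unfolding linear_iff
  by (metis add_cancel_left_left)+

lemma functional_bracket:
  "functional f \<Longrightarrow> functional (\<lambda>v. f (bracket v w))"
  "functional f \<Longrightarrow> functional (\<lambda>w. f (bracket v w))"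
  using functional_compose linear_left linear_right by blast+

text \<open>
  The transpose of the braiding applied to the factors \<open>i\<close> and \<open>i + 1\<close>.
\<close>

definition braid :: "nat \<Rightarrow> ('v list \<Rightarrow> 'k) \<Rightarrow> 'v list \<Rightarrow> 'k" where
  "braid i \<phi> = at_slot i (\<lambda>us v. case_list 0
     (\<lambda>w ws. \<phi> (us @ w # v # ws) + \<phi> (us @ one # bracket v w # ws)))"

lemma multilinear_braid:
  assumes "multilinear \<phi>"
  shows "multilinear (braid i \<phi>)"
proof -
  note slots = multilinearD[OF assms] multilinearD[OF assms, of "_ @ [_]", simplified]
  note rest = multilinear_append1[OF assms] multilinear_append2[OF assms, of "_ @ [_, _]", simplified]
  show ?thesis
    unfolding braid_def
  proof (intro multilinear_at_slot multilinear_case_list functional_intros multilinear_intros)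
    fix v ws
    show "multilinear (\<lambda>us. case ws of [] \<Rightarrow> 0
      | w # ws \<Rightarrow> \<phi> (us @ w # v # ws) + \<phi> (us @ one # bracket v w # ws))"
      by (cases ws) (auto intro: multilinear_intros rest)
  next
    fix us ws
    show "functional (\<lambda>v. case ws of [] \<Rightarrow> 0
      | w # ws \<Rightarrow> \<phi> (us @ w # v # ws) + \<phi> (us @ one # bracket v w # ws))"
      by (cases ws) (auto intro: functional_intros slots functional_bracket(1)[OF slots(2)])
  qed (auto intro: slots rest functional_bracket(2)[OF slots(2)])
qed

lemma braid_at:
  "i = Suc (length us) \<Longrightarrow> braid i \<phi> (us @ v # w # ws) = \<phi> (us @ w # v # ws) + \<phi> (us @ one # bracket v w # ws)"
  by (simp add: braid_def at_slot_eqs)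

lemma leibniz_braiding_lift:
  shows "\<sigma> \<in> tensor_hom scale 2 2"
    and "\<sigma> (pure_tensor scale [v, w]) = pure_tensor scale [w, v] + pure_tensor scale [one, bracket v w]"
    and "transpose_of 2 2 \<sigma> (braid 1)"
proof -
  let ?g = "\<lambda>vs. pure_tensor scale [vs ! 1, vs ! 0] + pure_tensor scale [one, bracket (vs ! 0) (vs ! 1)]"
  have g: "?g vs \<in> tensor_power scale 2" for vs
    by simp
  have F: "pairing \<phi> (?g vs) = braid 1 \<phi> vs" if "multilinear \<phi>" "length vs = 2" for \<phi> vs
    using that braid_at[of 1 "[]"]
    by (auto simp: numeral_2_eq_2 length_Suc_conv pairing_add[where m = "Suc (Suc 0)" and n = "Suc (Suc 0)"])
  have \<sigma>: "\<sigma> = tensor_lift scale 2 2 ?g" by (rule leibniz_braiding_def)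
  note lift = tensor_lift_transpose[where m = 2 and n = 2 and g = ?g and F = "braid 1"]
  show "\<sigma> \<in> tensor_hom scale 2 2"
    unfolding \<sigma> using lift(1) g multilinear_braid F by blast
  show "transpose_of 2 2 \<sigma> (braid 1)"
    unfolding \<sigma> using lift(3) g multilinear_braid F by blast
  have "\<sigma> (pure_tensor scale [v, w]) = ?g [v, w]"
    unfolding \<sigma> by (rule lift(2)) (use g multilinear_braid F in auto)
  then show "\<sigma> (pure_tensor scale [v, w]) = pure_tensor scale [w, v] + pure_tensor scale [one, bracket v w]"
    by simp
qed

lemma braiding_at_transpose:
  assumes "1 \<le> i" "i < n"
  shows "transpose_of n n (braiding_at scale \<sigma> n i) (braid i)"
proof -
  let ?g = "\<lambda>vs. tensor_prod scale (pure_tensor scale (take (i - 1) vs))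
       (tensor_prod scale (\<sigma> (pure_tensor scale [vs ! (i - 1), vs ! i]))
         (pure_tensor scale (drop (i + 1) vs)))"
  have split: "\<exists>us v w ws. vs = us @ v # w # ws \<and> i = Suc (length us)" if n: "length vs = n" for vs :: "'v list"
  proof -
    have "i \<le> length vs" using n assms by simp
    from list_slot[OF assms(1) this]
    obtain us v rest where 1: "vs = us @ v # rest" "i = Suc (length us)" .
    then obtain w ws where "rest = w # ws" using n assms by (cases rest) auto
    then show ?thesis using 1 by blast
  qed
  have g: "?g vs \<in> tensor_power scale n" if vs: "length vs = n" for vs
  proof -
    obtain us v w ws where "vs = us @ v # w # ws" "i = Suc (length us)"
      using split[OF vs] by blast
    moreover have "?g vs \<in> tensor_power scale (i - 1 + (2 + length (drop (i + 1) vs)))"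
      using vs assms leibniz_braiding_lift(1)
      by (intro tensor_power_closed pure_in_power) (auto simp: tensor_hom_def)
    ultimately show ?thesis using vs by simp
  qed
  have F: "pairing \<phi> (?g vs) = braid i \<phi> vs" if \<phi>: "multilinear \<phi>" and vs: "length vs = n" for \<phi> vs
  proof -
    obtain us v w ws where s: "vs = us @ v # w # ws" "i = Suc (length us)"
      using split[OF vs] by blast
    let ?P = "\<lambda>v w. pure_tensor scale [v, w]"
    have P: "?P x y \<in> tensor_power scale 2" for x y by simp
    have "?P w v + ?P one (bracket v w) \<in> tensor_power scale 2" by simp
    moreover have "tensor_prod scale (?P w v + ?P one (bracket v w)) (pure_tensor scale ws)
      \<in> tensor_power scale (2 + length ws)"
      by (intro tensor_power_closed) auto
    ultimately show ?thesis
      using \<phi> by (simp add: s nth_append leibniz_braiding_lift(2) pairing_pure_prod[where n = "2 + length ws"]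
        pairing_prod_pure[where m = 2] pairing_add[OF _ P P] multilinear_append1 multilinear_append2 braid_at
        multilinear_append1[OF multilinear_append2, simplified])
  qed
  show ?thesis
    unfolding braiding_at_def by (rule tensor_lift_transpose(3)[OF g multilinear_braid F])
qed

text \<open>
  On words \<open>u v w\<close> the two sides of the Yang--Baxter equation differ only in the terms starting
  with \<open>\<one>\<one>\<close>, and these agree by the Leibniz identity.
\<close>

lemma leibniz_braiding_is_braiding: "is_braiding scale \<sigma>"
  unfolding is_braiding_def
proof (intro conjI ballI)
  show "\<sigma> \<in> tensor_hom scale 2 2" by (rule leibniz_braiding_lift)
  fix A assume A: "A \<in> tensor_power scale 3"
  let ?s = "braiding_at scale \<sigma> 3"
  have s1: "transpose_of 3 3 (?s 1) (braid 1)" and s2: "transpose_of 3 3 (?s 2) (braid 2)"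
    by (rule braiding_at_transpose; simp)+
  show "?s 1 (?s 2 (?s 1 A)) = ?s 2 (?s 1 (?s 2 A))"
  proof (rule transpose_eqI[OF _ _ A])
    show "transpose_of 3 3 (\<lambda>A. ?s 1 (?s 2 (?s 1 A))) (\<lambda>\<phi>. braid 1 (braid 2 (braid 1 \<phi>)))"
      by (intro transpose_compose[OF s1] transpose_compose[OF s2] s1)
    show "transpose_of 3 3 (\<lambda>A. ?s 2 (?s 1 (?s 2 A))) (\<lambda>\<phi>. braid 2 (braid 1 (braid 2 \<phi>)))"
      by (intro transpose_compose[OF s1] transpose_compose[OF s2] s2)
  next
    fix \<phi> and vs :: "'v list" assume \<phi>: "multilinear \<phi>" and "length vs = 3"
    then obtain u v w where vs: "vs = [u, v, w]"
      by (auto simp: numeral_3_eq_3 length_Suc_conv)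
    have b1: "braid (Suc 0) \<psi> (x # y # zs) = \<psi> (y # x # zs) + \<psi> (one # bracket x y # zs)" for \<psi> x y zs
      using braid_at[of 1 "[]"] by simp
    have b2: "braid 2 \<psi> (z # x # y # zs) = \<psi> (z # y # x # zs) + \<psi> (z # one # bracket x y # zs)" for \<psi> x y z zs
      using braid_at[of 2 "[z]"] by simp
    have last: "functional (\<lambda>x. \<phi> [a, b, x])" for a b
      using multilinearD[OF \<phi>, of "[a, b]" "[]"] by simp
    have zero: "\<phi> [a, b, 0] = 0" "\<phi> [a, 0, b] = 0" for a b
      using functional_zero[OF multilinearD[OF \<phi>], of "[a, b]" "[]"]
        functional_zero[OF multilinearD[OF \<phi>], of "[a]" "[b]"] by simp_all
    have "\<phi> [one, one, bracket u (bracket v w)] =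
      \<phi> [one, one, bracket (bracket u v) w] - \<phi> [one, one, bracket (bracket u w) v]"
      using functional_diff[OF last] by (simp add: leibniz[of u v w])
    then show "braid 1 (braid 2 (braid 1 \<phi>)) vs = braid 2 (braid 1 (braid 2 \<phi>)) vs"
      by (simp add: vs b1 b2 one_left one_right bracket_zero zero)
  qed
qed

end

section \<open>Braided characters\<close>

context vector_space
begin

text \<open>
  The transpose of \<open>\<epsilon> \<otimes> Id\<close>.
\<close>

definition contract :: "('b \<Rightarrow> 'a) \<Rightarrow> ('b list \<Rightarrow> 'a) \<Rightarrow> 'b list \<Rightarrow> 'a" where
  "contract \<epsilon> \<phi> = case_list 0 (\<lambda>v ws. \<epsilon> v * \<phi> ws)"

lemma contract_Cons [simp]: "contract \<epsilon> \<phi> (v # ws) = \<epsilon> v * \<phi> ws"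
  by (simp add: contract_def)

lemma multilinear_contract: "functional \<epsilon> \<Longrightarrow> multilinear \<phi> \<Longrightarrow> multilinear (contract \<epsilon> \<phi>)"
  unfolding contract_def by (intro multilinear_case_list functional_intros multilinear_intros)

lemma char_left_transpose:
  assumes "functional \<epsilon>" "1 \<le> n"
  shows "transpose_of n (n - 1) (char_left scale \<epsilon> n) (contract \<epsilon>)"
  unfolding char_left_def
proof (rule tensor_lift_transpose(3)[OF _ multilinear_contract[OF assms(1)]])
  fix \<phi> and vs :: "'b list" assume "multilinear \<phi>" and "length vs = n"
  then show "pairing \<phi> (tensor_scale scale (\<epsilon> (hd vs)) (pure_tensor scale (tl vs))) = contract \<epsilon> \<phi> vs"
    using assms(2) by (cases vs) (auto simp: pairing_scale[OF _ pure_in_power])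
qed (use assms(2) in auto)

lemma char_char_transpose:
  assumes "functional \<epsilon>"
  shows "transpose_of 2 0 (char_char scale \<epsilon>) (\<lambda>\<phi>. contract \<epsilon> (contract \<epsilon> \<phi>))"
  unfolding char_char_def
proof (rule tensor_lift_transpose(3))
  fix \<phi> and vs :: "'b list" assume "multilinear \<phi>" and "length vs = 2"
  then show "pairing \<phi> (tensor_scale scale (\<epsilon> (vs ! 0) * \<epsilon> (vs ! 1)) (pure_tensor scale [])) =
    contract \<epsilon> (contract \<epsilon> \<phi>) vs"
    by (auto simp: pairing_scale[OF _ pure_in_power] numeral_2_eq_2 length_Suc_conv)
qed (auto intro: multilinear_contract assms)

end

context unital_leibniz
begin

text \<open>
  Compatibility of \<open>\<epsilon> \<otimes> \<epsilon>\<close> with the braiding says that \<open>\<epsilon>(\<one>) \<epsilon>([v, w])\<close> times the unit of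
  \<open>V\<^sup>\<otimes>\<^sup>0\<close> vanishes; the coefficient of the empty word is a multilinear functional that detects it.
\<close>

lemma braided_character_iff:
  "braided_character scale \<sigma> \<epsilon> \<longleftrightarrow> functional \<epsilon> \<and> (\<forall>v w. \<epsilon> one * \<epsilon> (bracket v w) = 0)"
proof (cases "functional \<epsilon>")
  case True
  let ?C = "\<lambda>\<phi>. contract \<epsilon> (contract \<epsilon> \<phi>)"
  note C = char_char_transpose[OF True]
  have \<sigma>C: "transpose_of 2 0 (\<lambda>A. char_char scale \<epsilon> (\<sigma> A)) (\<lambda>\<phi>. braid 1 (?C \<phi>))"
    by (rule transpose_compose[OF leibniz_braiding_lift(3) C])
  have eq: "braid 1 (?C \<phi>) [v, w] = ?C \<phi> [v, w] + \<epsilon> one * \<epsilon> (bracket v w) * \<phi> []" for \<phi> v w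
    using braid_at[of 1 "[]" "?C \<phi>" v w "[]"] by simp
  show ?thesis
  proof
    assume br: "braided_character scale \<sigma> \<epsilon>"
    \<comment> \<open>The coefficient of the empty word, multilinear since slots exist only in nonempty words.\<close>
    let ?\<phi> = "\<lambda>vs :: 'v list. if vs = [] then 1 else 0 :: 'k"
    have \<phi>: "multilinear ?\<phi>" by (simp add: multilinear_def functional_intros)
    have "\<epsilon> one * \<epsilon> (bracket v w) = 0" for v w
    proof -
      have p: "pure_tensor scale [v, w] \<in> tensor_power scale 2" by simp
      have "char_char scale \<epsilon> (\<sigma> (pure_tensor scale [v, w])) = char_char scale \<epsilon> (pure_tensor scale [v, w])"
        using br p by (simp add: braided_character_def)
      then have "braid 1 (?C ?\<phi>) [v, w] = ?C ?\<phi> [v, w]"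
        using transpose_ofD(2,3)[OF C \<phi>] transpose_ofD(2,3)[OF \<sigma>C \<phi>] p by (metis pairing_pure)
      then show ?thesis using eq[of ?\<phi> v w] by simp
    qed
    then show "functional \<epsilon> \<and> (\<forall>v w. \<epsilon> one * \<epsilon> (bracket v w) = 0)" using True by blast
  next
    assume *: "functional \<epsilon> \<and> (\<forall>v w. \<epsilon> one * \<epsilon> (bracket v w) = 0)"
    have "char_char scale \<epsilon> (\<sigma> A) = char_char scale \<epsilon> A" if "A \<in> tensor_power scale 2" for A
    proof (rule transpose_eqI[OF \<sigma>C C that])
      fix \<phi> and vs :: "'v list" assume "length vs = 2"
      then obtain v w where "vs = [v, w]" by (auto simp: numeral_2_eq_2 length_Suc_conv)
      then show "braid 1 (?C \<phi>) vs = ?C \<phi> vs" using conjunct2[OF *] by (simp only: eq) simp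
    qed
    then show "braided_character scale \<sigma> \<epsilon>" using True by (simp add: braided_character_def)
  qed
qed (simp add: braided_character_def)

lemma lie_character_braided: "lie_character scale bracket one \<epsilon> \<Longrightarrow> braided_character scale \<sigma> \<epsilon>"
  by (simp add: braided_character_iff lie_character_def)

end
section \<open>The adjoint action on words\<close>

context unital_leibniz
begin

text \<open>
  The transpose of the derivation of the tensor algebra that extends the right multiplication
  \<open>x \<mapsto> [x, v]\<close>.
\<close>

definition ad :: "'v \<Rightarrow> ('v list \<Rightarrow> 'k) \<Rightarrow> 'v list \<Rightarrow> 'k" where
  "ad v \<phi> us = (\<Sum>i<length us. \<phi> (us[i := bracket (us ! i) v]))"

lemma ad_Nil [simp]: "ad v \<phi> [] = 0"
  by (simp add: ad_def)

lemma ad_Cons: "ad v \<phi> (x # xs) = \<phi> (bracket x v # xs) + ad v (\<lambda>ys. \<phi> (x # ys)) xs"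
  by (simp add: ad_def sum.lessThan_Suc_shift del: sum.lessThan_Suc)

lemma ad_append: "ad v \<phi> (us @ ws) = ad v (\<lambda>xs. \<phi> (xs @ ws)) us + ad v (\<lambda>xs. \<phi> (us @ xs)) ws"
  by (induction us arbitrary: \<phi>) (auto simp: ad_Cons algebra_simps)

lemma ad_cong: "(\<And>xs. length xs = length us \<Longrightarrow> \<phi> xs = \<psi> xs) \<Longrightarrow> ad v \<phi> us = ad v \<psi> us"
  by (simp add: ad_def)

lemma ad_linear:
  "ad v (\<lambda>xs. \<phi> xs + \<psi> xs) us = ad v \<phi> us + ad v \<psi> us"
  "ad v (\<lambda>xs. \<phi> xs - \<psi> xs) us = ad v \<phi> us - ad v \<psi> us"
  "ad v (\<lambda>xs. c * \<phi> xs) us = c * ad v \<phi> us"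
  by (simp_all add: ad_def sum.distrib sum_subtractf sum_distrib_left)

text \<open>
  Actions on two disjoint blocks of letters commute.
\<close>

lemma ad_exchange:
  "ad u (\<lambda>xs. ad v (\<lambda>ys. F xs ys) ms) us = ad v (\<lambda>ys. ad u (\<lambda>xs. F xs ys) us) ms"
  unfolding ad_def by (rule sum.swap)

lemma ad_one: "multilinear \<phi> \<Longrightarrow> ad one \<phi> us = 0"
  unfolding ad_def
  by (intro sum.neutral) (auto simp: one_right functional_zero[OF multilinear_list_update])

lemma functional_ad: "multilinear \<phi> \<Longrightarrow> functional (\<lambda>v. ad v \<phi> us)"
  unfolding ad_def
  by (intro functional_intros functional_bracket(2) multilinear_list_update) auto

lemma multilinear_ad:
  assumes "multilinear \<phi>"
  shows "multilinear (ad v \<phi>)"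
  unfolding multilinear_def
proof (intro allI)
  fix us ws
  have "functional (\<lambda>x. ad v (\<lambda>xs. \<phi> (xs @ x # ws)) us)" "functional (\<lambda>x. ad v (\<lambda>ys. \<phi> (us @ x # ys)) ws)"
    unfolding ad_def by (intro functional_intros multilinearD[OF assms])+
  then show "functional (\<lambda>x. ad v \<phi> (us @ x # ws))"
    unfolding ad_append ad_Cons
    by (intro functional_intros functional_bracket(1)[OF multilinearD[OF assms]])
qed

text \<open>
  The Leibniz identity for a single letter says that the right multiplications satisfy
  \<open>[R\<^sub>v, R\<^sub>u] = R\<^bsub>[u,v]\<^esub>\<close>. Both sides act as derivations, so the identity passes to words.
\<close>

lemma ad_commutator:
  assumes "multilinear \<phi>"
  shows "ad v (ad u \<phi>) us + ad (bracket u v) \<phi> us = ad u (ad v \<phi>) us"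
  using assms
proof (induction us arbitrary: \<phi>)
  case (Cons x us)
  have "\<phi> (bracket x (bracket u v) # us) =
    \<phi> (bracket (bracket x u) v # us) - \<phi> (bracket (bracket x v) u # us)"
    using functional_diff[OF multilinear_hd[OF Cons.prems]] by (simp add: leibniz[of x u v])
  moreover have "ad v (ad u (\<lambda>ys. \<phi> (x # ys))) us + ad (bracket u v) (\<lambda>ys. \<phi> (x # ys)) us
    = ad u (ad v (\<lambda>ys. \<phi> (x # ys))) us"
    by (rule Cons.IH[OF multilinear_Cons[OF Cons.prems]])
  ultimately show ?case
    by (simp add: ad_Cons ad_linear algebra_simps)
qed simp

end

section \<open>The faces\<close>

locale leibniz_braided_character = unital_leibniz scale bracket one
  for scale :: "'k::field \<Rightarrow> 'v::ab_group_add \<Rightarrow> 'v" and bracket :: "'v \<Rightarrow> 'v \<Rightarrow> 'v" and one :: 'v +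
  fixes \<epsilon> :: "'v \<Rightarrow> 'k"
  assumes functional_character: "Vector_Spaces.linear scale (*) \<epsilon>"
    and character_bracket: "\<epsilon> one * \<epsilon> (bracket v w) = 0"
begin

text \<open>
  The transpose of the \<open>j\<close>-th face: the letter \<open>v\<close> in position \<open>j\<close> either acts on the letters
  before it or is evaluated.
\<close>

definition face :: "nat \<Rightarrow> ('v list \<Rightarrow> 'k) \<Rightarrow> 'v list \<Rightarrow> 'k" where
  "face j \<phi> = at_slot j (\<lambda>us v ws. \<epsilon> one * ad v (\<lambda>xs. \<phi> (xs @ ws)) us + \<epsilon> v * \<phi> (us @ ws))"

lemmas face_at = at_slot_eqs[where K = "\<lambda>us v ws. \<epsilon> one * ad v (\<lambda>xs. \<phi> (xs @ ws)) us + \<epsilon> v * \<phi> (us @ ws)" for \<phi>,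
    folded face_def, simplified]

lemma multilinear_face: "multilinear \<phi> \<Longrightarrow> multilinear (face j \<phi>)"
  unfolding face_def
proof (intro multilinear_at_slot)
  fix us ws :: "'v list" and v
  assume \<phi>: "multilinear \<phi>"
  note intros = multilinear_intros functional_intros multilinear_append1 multilinear_append2
  show "multilinear (\<lambda>us. \<epsilon> one * ad v (\<lambda>xs. \<phi> (xs @ ws)) us + \<epsilon> v * \<phi> (us @ ws))"
    by (intro intros multilinear_ad \<phi>)
  show "functional (\<lambda>v. \<epsilon> one * ad v (\<lambda>xs. \<phi> (xs @ ws)) us + \<epsilon> v * \<phi> (us @ ws))"
    by (intro intros functional_ad functional_character \<phi>)
  show "multilinear (\<lambda>ws. \<epsilon> one * ad v (\<lambda>xs. \<phi> (xs @ ws)) us + \<epsilon> v * \<phi> (us @ ws))"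
    unfolding ad_def by (intro intros \<phi>)
qed

lemma face_eq_bracket_omit:
  assumes "1 \<le> j" "j \<le> length vs"
  shows "face j \<phi> vs = \<epsilon> one * (\<Sum>i\<in>{1..<j}. \<phi> (bracket_omit bracket i j vs))
    + \<epsilon> (vs ! (j - 1)) * \<phi> (omit j vs)"
proof -
  obtain us v ws where vs: "vs = us @ v # ws" "j = Suc (length us)"
    using list_slot[OF assms] by blast
  have "(\<Sum>i\<in>{1..<j}. \<phi> (bracket_omit bracket i j vs)) =
    (\<Sum>i<length us. \<phi> (bracket_omit bracket (Suc i) j vs))"
    by (simp add: vs sum.shift_bounds_Suc_ivl lessThan_atLeast0 del: sum.op_ivl_Suc)
  also have "\<dots> = ad v (\<lambda>xs. \<phi> (xs @ ws)) us"
    unfolding ad_def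
    by (intro sum.cong) (auto simp: vs bracket_omit_def omit_def nth_append list_update_append)
  finally show ?thesis
    by (simp add: vs face_at omit_def)
qed

text \<open>
  The transpose of \<open>\<sigma>\<^sub>1 \<circ> \<dots> \<circ> \<sigma>\<^sub>k\<close>.
\<close>

primrec braid_chain :: "nat \<Rightarrow> ('v list \<Rightarrow> 'k) \<Rightarrow> 'v list \<Rightarrow> 'k" where
  "braid_chain 0 \<phi> = \<phi>"
| "braid_chain (Suc k) \<phi> = braid (Suc k) (braid_chain k \<phi>)"

text \<open>
  Moving \<open>v\<^sub>j\<close> to the front by the braiding leaves behind either the untouched letters or a bracket
  \<open>[v\<^sub>i, v\<^sub>j]\<close>. In the second case a letter \<open>\<one>\<close> travels on, and it is exchanged with the
  remaining letters without further correction, since brackets with \<open>\<one>\<close> vanish.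
\<close>

lemma braid_chain_contract:
  assumes \<phi>: "multilinear \<phi>"
  shows "length us = k \<Longrightarrow> braid_chain k (contract \<epsilon> \<phi>) (us @ v # ws) = face (Suc k) \<phi> (us @ v # ws)"
proof (induction k arbitrary: us v ws)
  case 0
  then show ?case using face_at(1)[of 1 "[]"] by simp
next
  case (Suc k)
  then obtain us' x where us: "us = us' @ [x]" "length us' = k"
    by (metis length_Suc_conv_rev)
  have "braid_chain (Suc k) (contract \<epsilon> \<phi>) (us @ v # ws) =
    face (Suc k) \<phi> (us' @ v # x # ws) + face (Suc k) \<phi> (us' @ one # bracket x v # ws)"
    using us Suc.IH[OF us(2)] by (simp add: braid_at)
  also have "\<dots> = face (Suc (Suc k)) \<phi> (us @ v # ws)"
    using us ad_one[OF multilinear_append1[OF \<phi>]]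
    by (simp add: face_at ad_append ad_Cons algebra_simps)
  finally show ?case .
qed

definition face_map :: "nat \<Rightarrow> nat \<Rightarrow> ('k, 'v) words set \<Rightarrow> ('k, 'v) words set" where
  "face_map n j = (\<lambda>A\<in>tensor_power scale n.
     char_left scale \<epsilon> n (foldr (\<circ>) (map (braiding_at scale \<sigma> n) [1..<j]) id A))"

lemma foldr_comp_id: "foldr (\<circ>) fs f A = foldr (\<circ>) fs id (f A)"
  by (induction fs) auto

lemma braiding_chain_transpose:
  "k < n \<Longrightarrow> transpose_of n n (foldr (\<circ>) (map (braiding_at scale \<sigma> n) [1..<Suc k]) id) (braid_chain k)"
proof (induction k)
  case 0
  show ?case using transpose_id by (simp add: id_def)
next
  case (Suc k)
  let ?\<beta> = "braiding_at scale \<sigma> n"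
  have eq: "foldr (\<circ>) (map ?\<beta> [1..<Suc (Suc k)]) id A = foldr (\<circ>) (map ?\<beta> [1..<Suc k]) id (?\<beta> (Suc k) A)" for A
    using foldr_comp_id[of "map ?\<beta> [1..<Suc k]" "?\<beta> (Suc k)"] by simp
  have "transpose_of n n (\<lambda>A. foldr (\<circ>) (map ?\<beta> [1..<Suc k]) id (?\<beta> (Suc k) A)) (\<lambda>\<phi>. braid (Suc k) (braid_chain k \<phi>))"
    using Suc by (intro transpose_compose[OF braiding_at_transpose]) auto
  then show ?case
    unfolding braid_chain.simps by (rule transpose_cong_map) (rule eq)
qed

lemma face_map_transpose:
  assumes "1 \<le> j" "j \<le> n"
  shows "transpose_of n (n - 1) (face_map n j) (face j)"
proof -
  have j: "Suc (j - 1) = j" using assms by simp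
  let ?chain = "foldr (\<circ>) (map (braiding_at scale \<sigma> n) [1..<j]) id"
  have "transpose_of n n ?chain (braid_chain (j - 1))"
    using braiding_chain_transpose[of "j - 1" n] assms unfolding j by simp
  then have "transpose_of n (n - 1) (\<lambda>A. char_left scale \<epsilon> n (?chain A)) (\<lambda>\<phi>. braid_chain (j - 1) (contract \<epsilon> \<phi>))"
    by (rule transpose_compose[OF _ char_left_transpose[OF functional_character]]) (use assms in simp)
  then have "transpose_of n (n - 1) (face_map n j) (\<lambda>\<phi>. braid_chain (j - 1) (contract \<epsilon> \<phi>))"
    by (rule transpose_cong_map) (simp add: face_map_def)
  then show ?thesis
  proof (rule transpose_cong)
    fix \<phi> and vs :: "'v list" assume \<phi>: "multilinear \<phi>" and "length vs = n"
    then obtain us v ws where "vs = us @ v # ws" "j = Suc (length us)"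
      using list_slot[OF assms(1)] assms(2) by metis
    then show "braid_chain (j - 1) (contract \<epsilon> \<phi>) vs = face j \<phi> vs"
      using braid_chain_contract[OF \<phi>] by simp
  qed (rule multilinear_face)
qed

lemma face_map_hom:
  assumes "1 \<le> j" "j \<le> n"
  shows "face_map n j \<in> tensor_hom scale n (n - 1)"
proof -
  have "restrict (face_map n j) (tensor_power scale n) = face_map n j"
    by (simp add: face_map_def)
  then show ?thesis using transpose_tensor_hom[OF face_map_transpose[OF assms]] by simp
qed

lemma face_map_pure:
  assumes "1 \<le> j" "j \<le> n" "length vs = n"
  shows "face_map n j (pure_tensor scale vs) = tensor_class scale
    (free_scale (\<epsilon> one) (\<Sum>i\<in>{1..<j}. word (bracket_omit bracket i j vs))
      + free_scale (\<epsilon> (vs ! (j - 1))) (word (omit j vs)))"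
proof (rule transpose_pure_eqI[OF face_map_transpose[OF assms(1,2)] assms(3)])
  fix \<phi> assume "multilinear \<phi>"
  then show "face j \<phi> vs = pairing \<phi> (tensor_class scale
    (free_scale (\<epsilon> one) (\<Sum>i\<in>{1..<j}. word (bracket_omit bracket i j vs))
      + free_scale (\<epsilon> (vs ! (j - 1))) (word (omit j vs))))"
    using assms by (simp add: face_eq_bracket_omit)
qed (use assms in \<open>auto simp: bracket_omit_def omit_def
  intro!: tensor_class_in_power homogeneous_add homogeneous_free_scale homogeneous_sum homogeneous_word\<close>)

text \<open>
  With \<open>u\<close> in position \<open>i\<close> and \<open>v\<close> in position \<open>j\<close>, both sides become polynomials in the actions of
  \<open>u\<close> and \<open>v\<close> on the letters before \<open>u\<close> and of \<open>v\<close> on the letters between them. They differ by the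
  commutator relation on the first block and by a multiple of \<open>\<epsilon>(\<one>) \<epsilon>([u, v])\<close>.
\<close>

lemma face_face:
  assumes \<phi>: "multilinear \<phi>" and "1 \<le> i" "i < j" "j \<le> length vs"
  shows "face j (face i \<phi>) vs = face i (face (j - 1) \<phi>) vs"
proof -
  obtain us u ms v ws where vs: "vs = us @ u # ms @ v # ws"
    "i = Suc (length us)" "j = Suc (Suc (length us + length ms))"
    using list_two_slots[OF assms(2-4)] by blast
  define \<psi> where "\<psi> xs ys = \<phi> (xs @ ys @ ws)" for xs ys
  have "multilinear (\<lambda>xs. \<psi> xs ms)"
    unfolding \<psi>_def by (rule multilinear_append1[OF \<phi>])
  note comm = ad_commutator[OF this, of v u us]
  have left: "face j (face i \<phi>) vs = \<epsilon> one * (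
      (\<epsilon> one * ad v (ad u (\<lambda>xs. \<psi> xs ms)) us + \<epsilon> u * ad v (\<lambda>xs. \<psi> xs ms) us)
      + (\<epsilon> one * ad (bracket u v) (\<lambda>xs. \<psi> xs ms) us + \<epsilon> (bracket u v) * \<psi> us ms)
      + (\<epsilon> one * ad v (\<lambda>ys. ad u (\<lambda>xs. \<psi> xs ys) us) ms + \<epsilon> u * ad v (\<psi> us) ms))
      + \<epsilon> v * (\<epsilon> one * ad u (\<lambda>xs. \<psi> xs ms) us + \<epsilon> u * \<psi> us ms)"
    by (simp add: vs face_at ad_append ad_Cons ad_linear \<psi>_def cong: ad_cong)
  have right: "face i (face (j - 1) \<phi>) vs =
      \<epsilon> one * (\<epsilon> one * (ad u (ad v (\<lambda>xs. \<psi> xs ms)) us + ad u (\<lambda>xs. ad v (\<psi> xs) ms) us)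
        + \<epsilon> v * ad u (\<lambda>xs. \<psi> xs ms) us)
      + \<epsilon> u * (\<epsilon> one * (ad v (\<lambda>xs. \<psi> xs ms) us + ad v (\<psi> us) ms) + \<epsilon> v * \<psi> us ms)"
    by (simp add: vs face_at ad_append ad_Cons ad_linear \<psi>_def cong: ad_cong)
  have "\<epsilon> one * (\<epsilon> (bracket u v) * \<psi> us ms) = 0"
    using character_bracket[of u v] by (metis mult.assoc mult_zero_left)
  then show ?thesis
    unfolding left right comm[symmetric] ad_exchange[of u v]
    by (simp add: algebra_simps)
qed

lemma pre_simplicial_face_map: "pre_simplicial scale face_map"
  unfolding pre_simplicial_def
proof (intro conjI allI impI ballI)
  fix n i j A assume ij: "1 \<le> i \<and> i < j \<and> j \<le> n" and A: "A \<in> tensor_power scale n"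
  show "face_map (n - 1) i (face_map n j A) = face_map (n - 1) (j - 1) (face_map n i A)"
  proof (rule transpose_eqI[OF _ _ A])
    show "transpose_of n (n - 1 - 1) (\<lambda>A. face_map (n - 1) i (face_map n j A)) (\<lambda>\<phi>. face j (face i \<phi>))"
      "transpose_of n (n - 1 - 1) (\<lambda>A. face_map (n - 1) (j - 1) (face_map n i A)) (\<lambda>\<phi>. face i (face (j - 1) \<phi>))"
      by (rule transpose_compose[OF face_map_transpose face_map_transpose]; use ij in auto)+
  qed (use ij face_face in auto)
qed (use face_map_hom in auto)

section \<open>The differential\<close>

abbreviation D :: "nat \<Rightarrow> ('k, 'v) words set \<Rightarrow> ('k, 'v) words set" where
  "D \<equiv> left_braided_differential scale \<sigma> \<epsilon>"

lemma D_eq_sum_faces: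
  assumes "A \<in> tensor_power scale n"
  shows "D n A = tensor_sum scale (\<lambda>j. tensor_scale scale ((-1) ^ (j - 1)) (face_map n j A)) {1..n}"
  using assms by (simp add: left_braided_differential_def face_map_def)

lemma D_transpose:
  "transpose_of n (n - 1) (D n) (\<lambda>\<phi> vs. \<Sum>j\<in>{1..n}. (-1) ^ (j - 1) * face j \<phi> vs)"
proof (rule transpose_cong_map[OF transpose_sum[OF finite_atLeastAtMost]])
  show "transpose_of n (n - 1) (face_map n j) (face j)" if "j \<in> {1..n}" for j
    using that by (intro face_map_transpose) auto
qed (rule D_eq_sum_faces)

lemma D_hom: "D n \<in> tensor_hom scale n (n - 1)"
proof -
  have "restrict (D n) (tensor_power scale n) = D n"
    by (simp add: left_braided_differential_def)
  then show ?thesis using transpose_tensor_hom[OF D_transpose] by metis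
qed

lemma D_power: "A \<in> tensor_power scale n \<Longrightarrow> D n A \<in> tensor_power scale (n - 1)"
  by (rule transpose_ofD(1)[OF D_transpose])

lemma pairing_D:
  assumes "multilinear \<phi>" "A \<in> tensor_power scale n"
  shows "pairing \<phi> (D n A) = (\<Sum>j\<in>{1..n}. (-1) ^ (j - 1) * pairing \<phi> (face_map n j A))"
proof -
  have f: "face_map n j A \<in> tensor_power scale (n - 1)" if "j \<in> {1..n}" for j
    using that assms(2) by (intro transpose_ofD(1)[OF face_map_transpose]) auto
  show ?thesis
    unfolding D_eq_sum_faces[OF assms(2)]
    using assms(1) f by (subst tensor_sum_power(2)[where n = "n - 1"]) (auto simp: pairing_scale[OF _ f])
qed

lemma D_pure:
  assumes "length vs = n"
  shows "D n (pure_tensor scale vs) = tensor_class scale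
    (free_scale (\<epsilon> one)
      (\<Sum>j\<in>{1..n}. \<Sum>i\<in>{1..<j}. free_scale ((-1) ^ (j - 1)) (word (bracket_omit bracket i j vs)))
      + (\<Sum>j\<in>{1..n}. free_scale ((-1) ^ (j - 1) * \<epsilon> (vs ! (j - 1))) (word (omit j vs))))"
  (is "_ = tensor_class scale ?x")
proof (rule transpose_pure_eqI[OF D_transpose assms])
  fix \<phi> assume \<phi>: "multilinear \<phi>"
  have "(\<Sum>j\<in>{1..n}. (-1) ^ (j - 1) * face j \<phi> vs) =
    (\<Sum>j\<in>{1..n}. \<epsilon> one * (\<Sum>i\<in>{1..<j}. (-1) ^ (j - 1) * \<phi> (bracket_omit bracket i j vs))
      + (-1) ^ (j - 1) * \<epsilon> (vs ! (j - 1)) * \<phi> (omit j vs))"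
    using assms by (intro sum.cong)
      (auto simp: face_eq_bracket_omit sum_distrib_left algebra_simps)
  then show "(\<Sum>j\<in>{1..n}. (-1) ^ (j - 1) * face j \<phi> vs) = pairing \<phi> (tensor_class scale ?x)"
    using \<phi> by (simp add: sum.distrib sum_distrib_left)
qed (use assms in \<open>auto simp: bracket_omit_def omit_def
  intro!: tensor_class_in_power homogeneous_add homogeneous_free_scale homogeneous_sum homogeneous_word\<close>)

text \<open>
  The term \<open>(i, j)\<close> with \<open>i < j\<close> cancels against the term \<open>(j - 1, i)\<close>. Passing from \<open>n\<close> to \<open>n + 1\<close>
  adds one row and one column, which cancel entry by entry.
\<close>

lemma alternating_double_sum:
  fixes a :: "nat \<Rightarrow> nat \<Rightarrow> 'r::comm_ring_1"
  assumes "\<And>i j. 1 \<le> i \<Longrightarrow> i < j \<Longrightarrow> j \<le> n \<Longrightarrow> a i j = a (j - 1) i"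
  shows "(\<Sum>j\<in>{1..n}. \<Sum>i\<in>{1..n - 1}. (-1) ^ (j - 1) * (-1) ^ (i - 1) * a i j) = 0"
  using assms
proof (induction n)
  case (Suc n)
  show ?case
  proof (cases n)
    case (Suc m)
    let ?t = "\<lambda>i j. (-1) ^ (j - 1) * (-1) ^ (i - 1) * a i j"
    have "(\<Sum>j\<in>{1..Suc n}. \<Sum>i\<in>{1..n}. ?t i j) =
      (\<Sum>j\<in>{1..n}. \<Sum>i\<in>{1..n - 1}. ?t i j) + ((\<Sum>j\<in>{1..n}. ?t n j) + (\<Sum>i\<in>{1..n}. ?t i (Suc n)))"
      by (simp add: Suc sum.distrib algebra_simps)
    also have "(\<Sum>j\<in>{1..n}. ?t n j) + (\<Sum>i\<in>{1..n}. ?t i (Suc n)) = (\<Sum>i\<in>{1..n}. ?t n i + ?t i (Suc n))"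
      by (rule sum.distrib[symmetric])
    also have "\<dots> = 0"
    proof (rule sum.neutral, rule ballI)
      fix i assume "i \<in> {1..n}"
      then have "a i (Suc n) = a n i" using Suc.prems[of i "Suc n"] by simp
      then show "?t n i + ?t i (Suc n) = 0" by (simp add: Suc)
    qed
    also have "(\<Sum>j\<in>{1..n}. \<Sum>i\<in>{1..n - 1}. ?t i j) = 0"
      using Suc.prems by (intro Suc.IH) auto
    finally show ?thesis by simp
  qed simp
qed simp

lemma D_D:
  assumes A: "A \<in> tensor_power scale n"
  shows "D (n - 1) (D n A) = tensor_zero scale"
proof (rule tensor_eqI)
  show "D (n - 1) (D n A) \<in> tensor_power scale (n - 1 - 1)"
    using A by (intro D_power)
  fix \<phi> assume \<phi>: "multilinear \<phi>"
  let ?a = "\<lambda>i j. pairing \<phi> (face_map (n - 1) i (face_map n j A))"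
  have "pairing \<phi> (face_map (n - 1) i (D n A)) = (\<Sum>j\<in>{1..n}. (-1) ^ (j - 1) * ?a i j)"
    if i: "i \<in> {1..n - 1}" for i
  proof -
    have t: "transpose_of (n - 1) (n - 1 - 1) (face_map (n - 1) i) (face i)"
      using i by (intro face_map_transpose) auto
    have f: "face_map n j A \<in> tensor_power scale (n - 1)" if "j \<in> {1..n}" for j
      using that A by (intro transpose_ofD(1)[OF face_map_transpose]) auto
    have "pairing \<phi> (face_map (n - 1) i (D n A)) = pairing (face i \<phi>) (D n A)"
      by (rule transpose_ofD(3)[OF t \<phi> D_power[OF A]])
    also have "\<dots> = (\<Sum>j\<in>{1..n}. (-1) ^ (j - 1) * pairing (face i \<phi>) (face_map n j A))"
      by (rule pairing_D[OF multilinear_face[OF \<phi>] A])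
    also have "\<dots> = (\<Sum>j\<in>{1..n}. (-1) ^ (j - 1) * ?a i j)"
      using f by (intro sum.cong refl) (simp only: transpose_ofD(3)[OF t \<phi>])
    finally show ?thesis .
  qed
  then have "pairing \<phi> (D (n - 1) (D n A)) =
    (\<Sum>i\<in>{1..n - 1}. \<Sum>j\<in>{1..n}. (-1) ^ (j - 1) * (-1) ^ (i - 1) * ?a i j)"
    unfolding pairing_D[OF \<phi> D_power[OF A]] by (simp add: sum_distrib_left mult_ac del: One_nat_def)
  also have "\<dots> = (\<Sum>j\<in>{1..n}. \<Sum>i\<in>{1..n - 1}. (-1) ^ (j - 1) * (-1) ^ (i - 1) * ?a i j)"
    by (rule sum.swap)
  also have "\<dots> = 0"
    using pre_simplicial_face_map A
    by (intro alternating_double_sum) (simp add: pre_simplicial_def del: One_nat_def)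
  finally show "pairing \<phi> (D (n - 1) (D n A)) = pairing \<phi> (tensor_zero scale)"
    using \<phi> by simp
qed auto

lemma tensor_differential_D: "tensor_differential scale D"
  unfolding tensor_differential_def
proof (intro conjI allI ballI D_hom)
  fix A assume "A \<in> tensor_power scale 0"
  then show "D 0 A = tensor_zero scale"
    using D_power[of A 0] by (intro tensor_eqI[of _ 0 _ 0]) (auto simp: pairing_D)
qed (rule D_D)

section \<open>Acyclicity\<close>

definition insert_one :: "nat \<Rightarrow> ('k, 'v) words set \<Rightarrow> ('k, 'v) words set" where
  "insert_one n = tensor_lift scale n (n + 1) (\<lambda>vs. pure_tensor scale (one # vs))"

lemma insert_one_transpose: "transpose_of n (n + 1) (insert_one n) (\<lambda>\<phi> vs. \<phi> (one # vs))"
  unfolding insert_one_def by (rule tensor_lift_transpose(3)) (auto intro: multilinear_Cons)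

text \<open>
  The first letter has nothing to act on, so the first face of \<open>\<one> v\<^sub>1 \<dots> v\<^sub>n\<close> is \<open>\<epsilon>(\<one>) v\<^sub>1 \<dots> v\<^sub>n\<close>;
  the other letters do not see the prefix, as their action on \<open>\<one>\<close> is zero.
\<close>

lemma face_insert_one:
  assumes A: "A \<in> tensor_power scale n"
  shows "\<epsilon> one = 1 \<Longrightarrow> face_map (n + 1) 1 (insert_one n A) = A"
    and "1 \<le> j \<Longrightarrow> j \<le> n \<Longrightarrow> face_map (n + 1) (j + 1) (insert_one n A) = insert_one (n - 1) (face_map n j A)"
proof -
  assume "\<epsilon> one = 1"
  show "face_map (n + 1) 1 (insert_one n A) = A"
  proof (rule transpose_eqI[OF _ transpose_id A])
    show "transpose_of n n (\<lambda>A. face_map (n + 1) 1 (insert_one n A)) (\<lambda>\<phi> vs. face 1 \<phi> (one # vs))"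
      using transpose_compose[OF insert_one_transpose face_map_transpose[of 1 "n + 1"]]
      by (simp del: One_nat_def)
    show "face 1 \<phi> (one # vs) = \<phi> vs" for \<phi> vs
      using face_at(1)[of 1 "[]"] \<open>\<epsilon> one = 1\<close> by simp
  qed
next
  assume j: "1 \<le> j" "j \<le> n"
  show "face_map (n + 1) (j + 1) (insert_one n A) = insert_one (n - 1) (face_map n j A)"
  proof (rule transpose_eqI[OF _ _ A])
    show "transpose_of n n (\<lambda>A. face_map (n + 1) (j + 1) (insert_one n A)) (\<lambda>\<phi> vs. face (j + 1) \<phi> (one # vs))"
      using transpose_compose[OF insert_one_transpose face_map_transpose[of "j + 1" "n + 1"]] j by simp
    show "transpose_of n n (\<lambda>A. insert_one (n - 1) (face_map n j A)) (\<lambda>\<phi>. face j (\<lambda>vs. \<phi> (one # vs)))"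
      using transpose_compose[OF face_map_transpose insert_one_transpose] j by fastforce
    fix \<phi> and vs :: "'v list" assume \<phi>: "multilinear \<phi>" and "length vs = n"
    then obtain us v ws where vs: "vs = us @ v # ws" "j = Suc (length us)"
      using list_slot[OF j(1)] j(2) by metis
    show "face (j + 1) \<phi> (one # vs) = face j (\<lambda>vs. \<phi> (one # vs)) vs"
      using face_at(1)[of "j + 1" "one # us" \<phi> v ws] functional_zero[OF multilinear_hd[OF \<phi>]]
      by (simp add: vs face_at(1) ad_Cons one_left)
  qed
qed

text \<open>
  Prefixing \<open>\<one>\<close> is a contracting homotopy: the first face undoes it, and it shifts the index of
  all other faces, hence reverses their signs.
\<close>

lemma pairing_D_insert_one:
  assumes \<phi>: "multilinear \<phi>" and A: "A \<in> tensor_power scale n" and "\<epsilon> one = 1"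
  shows "pairing \<phi> (D (n + 1) (insert_one n A)) = pairing \<phi> A - pairing (\<lambda>vs. \<phi> (one # vs)) (D n A)"
proof -
  have h: "insert_one n A \<in> tensor_power scale (n + 1)"
    using A by (rule transpose_ofD(1)[OF insert_one_transpose])
  have shift: "pairing \<phi> (face_map (Suc n) (Suc j) (insert_one n A)) =
    pairing (\<lambda>vs. \<phi> (one # vs)) (face_map n j A)" if j: "j \<in> {1..n}" for j
  proof -
    have "face_map n j A \<in> tensor_power scale (n - 1)"
      using j A by (intro transpose_ofD(1)[OF face_map_transpose]) auto
    then show ?thesis
      using j face_insert_one(2)[OF A, of j] transpose_ofD(3)[OF insert_one_transpose \<phi>] by simp
  qed
  have "pairing \<phi> (D (n + 1) (insert_one n A)) =
    (\<Sum>j\<in>{1..Suc n}. (-1) ^ (j - 1) * pairing \<phi> (face_map (Suc n) j (insert_one n A)))"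
    using pairing_D[OF \<phi> h] by simp
  also have "\<dots> = pairing \<phi> (face_map (Suc n) 1 (insert_one n A)) +
    (\<Sum>j\<in>{1..n}. (-1) ^ j * pairing \<phi> (face_map (Suc n) (Suc j) (insert_one n A)))"
    by (simp add: sum.shift_bounds_cl_Suc_ivl sum.atLeast_Suc_atMost[of 0] del: sum.cl_ivl_Suc)
  also have "\<dots> = pairing \<phi> A +
    (\<Sum>j\<in>{1..n}. - ((-1) ^ (j - 1) * pairing (\<lambda>vs. \<phi> (one # vs)) (face_map n j A)))"
  proof (intro arg_cong2[where f = "(+)"] sum.cong)
    show "pairing \<phi> (face_map (Suc n) 1 (insert_one n A)) = pairing \<phi> A"
      using face_insert_one(1)[OF A] assms(3) by simp
    fix j assume j: "j \<in> {1..n}"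
    then obtain k where "j = Suc k" by (cases j) auto
    then show "(-1) ^ j * pairing \<phi> (face_map (Suc n) (Suc j) (insert_one n A)) =
      - ((-1) ^ (j - 1) * pairing (\<lambda>vs. \<phi> (one # vs)) (face_map n j A))"
      using shift[OF j] by simp
  qed simp
  also have "\<dots> = pairing \<phi> A - pairing (\<lambda>vs. \<phi> (one # vs)) (D n A)"
    using pairing_D[OF multilinear_Cons[OF \<phi>] A] by (simp add: sum_negf)
  finally show ?thesis .
qed

lemma tensor_acyclic_D:
  assumes "\<epsilon> one = 1"
  shows "tensor_acyclic scale D"
  unfolding tensor_acyclic_def
proof (intro allI equalityI subsetI)
  fix n A assume "A \<in> {A \<in> tensor_power scale n. D n A = tensor_zero scale}"
  then have A: "A \<in> tensor_power scale n" "D n A = tensor_zero scale" by auto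
  have h: "insert_one n A \<in> tensor_power scale (n + 1)"
    using A by (intro transpose_ofD(1)[OF insert_one_transpose])
  have "A = D (n + 1) (insert_one n A)"
  proof (rule tensor_eqI[OF A(1) D_power[OF h]])
    fix \<phi> assume "multilinear \<phi>"
    then show "pairing \<phi> A = pairing \<phi> (D (n + 1) (insert_one n A))"
      using A assms by (subst pairing_D_insert_one) (auto simp: multilinear_Cons)
  qed
  then show "A \<in> D (n + 1) ` tensor_power scale (n + 1)"
    using h by blast
next
  fix n A assume "A \<in> D (n + 1) ` tensor_power scale (n + 1)"
  then obtain B where B: "B \<in> tensor_power scale (n + 1)" "A = D (n + 1) B" by blast
  then show "A \<in> {A \<in> tensor_power scale n. D n A = tensor_zero scale}"
    using D_power[OF B(1)] D_D[OF B(1)] by simp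
qed

end
section \<open>Splittings and degeneracies\<close>

context unital_leibniz
begin

text \<open>
  The coordinate along \<open>\<one>\<close> turns a splitting into a Lie character with kernel \<open>V'\<close>: a bracket
  depends only on the \<open>V'\<close>-components of its arguments, hence lies in \<open>V'\<close>.
\<close>

lemma splitting_lie_character:
  assumes split: "leibniz_splitting scale bracket one V'"
  obtains \<theta> where "lie_character scale bracket one \<theta>" "V' = {v. \<theta> v = 0}"
proof -
  have V': "subspace V'" and closed: "\<And>v w. v \<in> V' \<Longrightarrow> w \<in> V' \<Longrightarrow> bracket v w \<in> V'"
    and one: "one \<noteq> 0" and sum: "V' + span {one} = UNIV" and int: "V' \<inter> span {one} = {0}"
    using split by (auto simp: leibniz_splitting_def)
  have "\<exists>c. v - scale c one \<in> V'" for v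
  proof -
    have "v \<in> V' + span {one}" using sum by simp
    then obtain a b where ab: "v = a + b" "a \<in> V'" "b \<in> span {one}" by (rule set_plus_elim)
    then obtain c where "b = scale c one" by (auto simp: span_singleton)
    then show ?thesis using ab by (intro exI[of _ c]) simp
  qed
  then obtain \<theta> where \<theta>: "v - scale (\<theta> v) one \<in> V'" for v by metis
  \<comment> \<open>The coordinate is unique: two candidates differ by an element of \<open>V' \<inter> \<bbbk>\<one> = {0}\<close>.\<close>
  have unique: "\<theta> v = c" if "v - scale c one \<in> V'" for v c
  proof -
    have "scale (c - \<theta> v) one = (v - scale (\<theta> v) one) - (v - scale c one)"
      by (simp add: algebra_simps)
    also have "\<dots> \<in> V'" by (rule subspace_diff[OF V' \<theta> that])
    finally have "scale (c - \<theta> v) one \<in> V' \<inter> span {one}"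
      by (auto simp: span_singleton)
    then show ?thesis using int one by simp
  qed
  have "\<theta> (v + w) = \<theta> v + \<theta> w" for v w
    using subspace_add[OF V' \<theta>[of v] \<theta>[of w]] by (intro unique) (simp add: algebra_simps)
  moreover have "\<theta> (scale c v) = c * \<theta> v" for c v
    using subspace_scale[OF V' \<theta>[of v], of c] by (intro unique) (simp add: algebra_simps)
  moreover have "\<theta> (bracket v w) = 0" for v w
  proof (rule unique)
    have l: "bracket (x - y) z = bracket x z - bracket y z" "bracket (scale c x) z = scale c (bracket x z)"
      and r: "bracket z (x - y) = bracket z x - bracket z y" "bracket z (scale c x) = scale c (bracket z x)" for x y z c
      using module_hom.diff[OF linear_left[unfolded linear_iff_module_hom], of x y z]
        module_hom.scale[OF linear_left[unfolded linear_iff_module_hom], of c x z]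
        module_hom.diff[OF linear_right[unfolded linear_iff_module_hom], of z x y]
        module_hom.scale[OF linear_right[unfolded linear_iff_module_hom], of z c x]
      by simp_all
    have "bracket v w = bracket (v - scale (\<theta> v) one) (w - scale (\<theta> w) one)"
      by (simp add: l r one_left one_right)
    then show "bracket v w - scale 0 one \<in> V'"
      using closed[OF \<theta> \<theta>] by simp
  qed
  moreover have "\<theta> one = 1"
    using subspace_0[OF V'] by (intro unique) simp
  ultimately have "lie_character scale bracket one \<theta>"
    by (simp add: lie_character_def functional_iff)
  moreover have "V' = {v. \<theta> v = 0}"
  proof (intro set_eqI iffI)
    show "v \<in> {v. \<theta> v = 0}" if "v \<in> V'" for v
      using that unique[of v 0] by simp
    show "v \<in> V'" if "v \<in> {v. \<theta> v = 0}" for v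
      using that \<theta>[of v] by simp
  qed
  ultimately show ?thesis by (rule that)
qed

text \<open>
  The transpose of the map replacing the letter \<open>v\<close> in position \<open>i\<close> by
  \<open>\<one> v + v \<one> - \<theta>(v) \<one> \<one>\<close>. For \<open>\<theta>(v) = 0\<close> this is \<open>\<one> v + v \<one>\<close>, and for \<open>v = \<one>\<close> with
  \<open>\<theta>(\<one>) = 1\<close> it is \<open>\<one> \<one>\<close>.
\<close>

definition degeneracy :: "('v \<Rightarrow> 'k) \<Rightarrow> nat \<Rightarrow> ('v list \<Rightarrow> 'k) \<Rightarrow> 'v list \<Rightarrow> 'k" where
  "degeneracy \<theta> i \<phi> = at_slot i (\<lambda>us v ws.
     \<phi> (us @ one # v # ws) + \<phi> (us @ v # one # ws) - \<theta> v * \<phi> (us @ one # one # ws))"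

lemmas degeneracy_at = at_slot_eqs[where K = "\<lambda>us v ws.
     \<phi> (us @ one # v # ws) + \<phi> (us @ v # one # ws) - \<theta> v * \<phi> (us @ one # one # ws)" for \<phi> \<theta>,
    folded degeneracy_def, simplified]

lemma multilinear_degeneracy:
  assumes "functional \<theta>" "multilinear \<phi>"
  shows "multilinear (degeneracy \<theta> i \<phi>)"
  unfolding degeneracy_def
proof (intro multilinear_at_slot)
  note intros = multilinear_intros functional_intros multilinear_append1[OF assms(2)]
    multilinear_append2[OF assms(2), of "_ @ [_, _]", simplified]
    multilinearD[OF assms(2)] multilinearD[OF assms(2), of "_ @ [_]", simplified] assms(1)
  fix us ws v
  show "multilinear (\<lambda>us. \<phi> (us @ one # v # ws) + \<phi> (us @ v # one # ws) - \<theta> v * \<phi> (us @ one # one # ws))"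
    "functional (\<lambda>v. \<phi> (us @ one # v # ws) + \<phi> (us @ v # one # ws) - \<theta> v * \<phi> (us @ one # one # ws))"
    "multilinear (\<lambda>ws. \<phi> (us @ one # v # ws) + \<phi> (us @ v # one # ws) - \<theta> v * \<phi> (us @ one # one # ws))"
    by (intro intros)+
qed

definition degeneracy_map :: "('v \<Rightarrow> 'k) \<Rightarrow> nat \<Rightarrow> nat \<Rightarrow> ('k, 'v) words set \<Rightarrow> ('k, 'v) words set" where
  "degeneracy_map \<theta> n i = tensor_lift scale n (n + 1) (\<lambda>vs.
     pure_tensor scale (take (i - 1) vs @ [one] @ drop (i - 1) vs) +
     pure_tensor scale (take i vs @ [one] @ drop i vs) +
     tensor_scale scale (- \<theta> (vs ! (i - 1)))
       (pure_tensor scale (take (i - 1) vs @ [one, one] @ drop i vs)))"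

lemma degeneracy_map_lift:
  assumes "functional \<theta>" "1 \<le> i" "i \<le> n"
  shows "degeneracy_map \<theta> n i \<in> tensor_hom scale n (n + 1)"
    and "transpose_of n (n + 1) (degeneracy_map \<theta> n i) (degeneracy \<theta> i)"
proof -
  let ?g = "\<lambda>vs. pure_tensor scale (take (i - 1) vs @ [one] @ drop (i - 1) vs) +
     pure_tensor scale (take i vs @ [one] @ drop i vs) +
     tensor_scale scale (- \<theta> (vs ! (i - 1)))
       (pure_tensor scale (take (i - 1) vs @ [one, one] @ drop i vs))"
  have p: "pure_tensor scale (take (i - 1) vs @ [one] @ drop (i - 1) vs) \<in> tensor_power scale (n + 1)"
    "pure_tensor scale (take i vs @ [one] @ drop i vs) \<in> tensor_power scale (n + 1)"
    "pure_tensor scale (take (i - 1) vs @ [one, one] @ drop i vs) \<in> tensor_power scale (n + 1)"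
    if "length vs = n" for vs
    using that assms by auto
  have g: "?g vs \<in> tensor_power scale (n + 1)" if "length vs = n" for vs
    using p[OF that] by (intro tensor_power_closed)
  have F: "pairing \<phi> (?g vs) = degeneracy \<theta> i \<phi> vs" if \<phi>: "multilinear \<phi>" and n: "length vs = n" for \<phi> vs
  proof -
    have "i \<le> length vs" using assms(3) n by simp
    from list_slot[OF assms(2) this]
    obtain us v ws where vs: "vs = us @ v # ws" "i = Suc (length us)" .
    have "pairing \<phi> (?g vs) = pairing \<phi> (pure_tensor scale (take (i - 1) vs @ [one] @ drop (i - 1) vs)) +
      pairing \<phi> (pure_tensor scale (take i vs @ [one] @ drop i vs)) +
      - \<theta> (vs ! (i - 1)) * pairing \<phi> (pure_tensor scale (take (i - 1) vs @ [one, one] @ drop i vs))"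
      unfolding pairing_add[OF \<phi> tensor_power_closed(1)[OF p(1,2)[OF n]] tensor_power_closed(2)[OF p(3)[OF n]]]
        pairing_add[OF \<phi> p(1,2)[OF n]] pairing_scale[OF \<phi> p(3)[OF n]] ..
    then show ?thesis using \<phi> by (simp add: vs degeneracy_at)
  qed
  note lift = tensor_lift_transpose[where m = n and n = "n + 1" and g = ?g and F = "degeneracy \<theta> i"]
  show "degeneracy_map \<theta> n i \<in> tensor_hom scale n (n + 1)"
    unfolding degeneracy_map_def using lift(1) g multilinear_degeneracy[OF assms(1)] F by blast
  show "transpose_of n (n + 1) (degeneracy_map \<theta> n i) (degeneracy \<theta> i)"
    unfolding degeneracy_map_def using lift(3) g multilinear_degeneracy[OF assms(1)] F by blast
qed

lemma pure_tensor_slot_linear: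
  "pure_tensor scale (us @ (v + scale c w) # ws) =
    pure_tensor scale (us @ v # ws) + tensor_scale scale c (pure_tensor scale (us @ w # ws))"
proof (rule tensor_eqI)
  let ?n = "Suc (length us + length ws)"
  have p: "pure_tensor scale (us @ x # ws) \<in> tensor_power scale ?n" for x by simp
  show "pure_tensor scale (us @ (v + scale c w) # ws) \<in> tensor_power scale ?n" by (rule p)
  show "pure_tensor scale (us @ v # ws) + tensor_scale scale c (pure_tensor scale (us @ w # ws))
    \<in> tensor_power scale ?n"
    by (intro tensor_power_closed p)
  fix \<phi> assume \<phi>: "multilinear \<phi>"
  show "pairing \<phi> (pure_tensor scale (us @ (v + scale c w) # ws)) =
    pairing \<phi> (pure_tensor scale (us @ v # ws) + tensor_scale scale c (pure_tensor scale (us @ w # ws)))"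
    unfolding pairing_add[OF \<phi> p tensor_power_closed(2)[OF p]] pairing_scale[OF \<phi> p]
    using \<phi> multilinearD[OF \<phi>, of us ws] by (simp add: functional_iff)
qed

text \<open>
  The two prescribed cases are instances of the single linear formula
  \<open>\<one> v + v \<one> - \<theta>(v) \<one> \<one>\<close>; they determine the map since every vector is the sum of one in \<open>V'\<close>
  and a multiple of \<open>\<one>\<close>.
\<close>

lemma leibniz_degeneracy_iff:
  assumes \<theta>: "lie_character scale bracket one \<theta>" and i: "1 \<le> i" "i \<le> n"
  shows "leibniz_degeneracy scale one {v. \<theta> v = 0} n i f \<longleftrightarrow> f = degeneracy_map \<theta> n i"
proof -
  have lin: "functional \<theta>" and one: "\<theta> one = 1" using \<theta> by (auto simp: lie_character_def)
  note s = degeneracy_map_lift[OF lin i]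
  have prescribed: "leibniz_degeneracy scale one {v. \<theta> v = 0} n i (degeneracy_map \<theta> n i)"
    unfolding leibniz_degeneracy_def
  proof (intro conjI allI impI s(1))
    fix vs :: "'v list" assume n: "length vs = n"
    then have "i \<le> length vs" using i(2) by simp
    from list_slot[OF i(1) this]
    obtain us v ws where vs: "vs = us @ v # ws" "i = Suc (length us)" .
    note pure_eqI = transpose_pure_eqI[OF s(2) n]
    have p: "pure_tensor scale (us @ one # v # ws) \<in> tensor_power scale (n + 1)"
      "pure_tensor scale (us @ v # one # ws) \<in> tensor_power scale (n + 1)"
      using n vs by auto
    {
      assume "vs ! (i - 1) \<in> {v. \<theta> v = 0}"
      then have "\<theta> v = 0" by (simp add: vs)
      then have "degeneracy_map \<theta> n i (pure_tensor scale vs) =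
        pure_tensor scale (us @ one # v # ws) + pure_tensor scale (us @ v # one # ws)"
        using p by (intro pure_eqI) (auto simp: vs(1) vs(2) degeneracy_at pairing_add[OF _ p])
      then show "degeneracy_map \<theta> n i (pure_tensor scale vs) =
        pure_tensor scale (take (i - 1) vs @ [one] @ drop (i - 1) vs) +
        pure_tensor scale (take i vs @ [one] @ drop i vs)"
        by (simp add: vs)
    next
      assume "vs ! (i - 1) = one"
      then have "v = one" by (simp add: vs)
      then have "degeneracy_map \<theta> n i (pure_tensor scale vs) = pure_tensor scale (us @ one # one # ws)"
        using p one by (intro pure_eqI) (auto simp: vs(1) vs(2) degeneracy_at)
      then show "degeneracy_map \<theta> n i (pure_tensor scale vs) =
        pure_tensor scale (take (i - 1) vs @ [one, one] @ drop i vs)"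
        by (simp add: vs)
    }
  qed
  moreover have "f = degeneracy_map \<theta> n i" if f: "leibniz_degeneracy scale one {v. \<theta> v = 0} n i f"
  proof (rule tensor_hom_eqI)
    let ?s = "degeneracy_map \<theta> n i"
    show hom: "f \<in> tensor_hom scale n (n + 1)" "?s \<in> tensor_hom scale n (n + 1)"
      using f s(1) by (auto simp: leibniz_degeneracy_def)
    fix vs :: "'v list" assume n: "length vs = n"
    then have "i \<le> length vs" using i(2) by simp
    from list_slot[OF i(1) this]
    obtain us v ws where vs: "vs = us @ v # ws" "i = Suc (length us)" .
    \<comment> \<open>The component of \<open>v\<close> in \<open>V'\<close>.\<close>
    let ?v = "v - scale (\<theta> v) one"
    have "\<theta> ?v = 0" using lin one by (simp add: functional_diff functional_iff)
    then have "f (pure_tensor scale (us @ ?v # ws)) = ?s (pure_tensor scale (us @ ?v # ws))"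
      "f (pure_tensor scale (us @ one # ws)) = ?s (pure_tensor scale (us @ one # ws))"
      using f prescribed n vs unfolding leibniz_degeneracy_def by simp_all
    moreover have "pure_tensor scale (us @ ?v # ws) \<in> tensor_power scale n"
      "pure_tensor scale (us @ one # ws) \<in> tensor_power scale n"
      using n vs by auto
    moreover have "pure_tensor scale vs =
      pure_tensor scale (us @ ?v # ws) + tensor_scale scale (\<theta> v) (pure_tensor scale (us @ one # ws))"
      using pure_tensor_slot_linear[of us ?v "\<theta> v" one ws] by (simp add: vs)
    ultimately show "f (pure_tensor scale vs) = ?s (pure_tensor scale vs)"
      using hom by (simp add: tensor_hom_def)
  qed
  ultimately show ?thesis by blast
qed

text \<open>
  For different positions the two operations are independent. For equal ones this is the
  coassociativity of \<open>v \<mapsto> \<one> v + v \<one> - \<theta>(v) \<one> \<one>\<close>: applied to either tensor factor it yields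
  \<open>\<one> \<one> v + \<one> v \<one> + v \<one> \<one> - 2 \<theta>(v) \<one> \<one> \<one>\<close>, by \<open>\<theta>(\<one>) = 1\<close>.
\<close>

lemma degeneracy_degeneracy:
  assumes \<theta>: "lie_character scale bracket one \<theta>" and "1 \<le> i" "i \<le> j" "j \<le> length vs"
  shows "degeneracy \<theta> j (degeneracy \<theta> i \<phi>) vs = degeneracy \<theta> i (degeneracy \<theta> (j + 1) \<phi>) vs"
proof (cases "i = j")
  case True
  have "1 \<le> i" "i \<le> length vs" using assms by auto
  from list_slot[OF this] obtain us v ws where vs: "vs = us @ v # ws" "i = Suc (length us)" .
  show ?thesis
    using True \<theta> by (simp add: vs lie_character_def degeneracy_at algebra_simps)
next
  case False
  then have "i < j" using assms by simp
  from list_two_slots[OF assms(2) this assms(4)]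
  obtain us u ms v ws where vs: "vs = us @ u # ms @ v # ws"
    "i = Suc (length us)" "j = Suc (Suc (length us + length ms))" .
  show ?thesis
    by (simp add: vs degeneracy_at algebra_simps)
qed

end

context leibniz_braided_character
begin

text \<open>
  The face removing \<open>u\<close> acts only on letters before \<open>u\<close>, and the degeneracy changes a letter
  behind \<open>u\<close>.
\<close>

lemma degeneracy_face_before:
  assumes "1 \<le> i" "i < j" "j \<le> length vs"
  shows "degeneracy \<theta> j (face i \<phi>) vs = face i (degeneracy \<theta> (j - 1) \<phi>) vs"
proof -
  from list_two_slots[OF assms]
  obtain us u ms v ws where vs: "vs = us @ u # ms @ v # ws"
    "i = Suc (length us)" "j = Suc (Suc (length us + length ms))" .
  show ?thesis
    by (simp add: vs degeneracy_at face_at ad_linear algebra_simps cong: ad_cong)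
qed

text \<open>
  The letter \<open>u\<close> now acts on the doubled letter. As \<open>[\<one>, u] = 0\<close>, it sends
  \<open>\<one> v + v \<one> - \<theta>(v) \<one> \<one>\<close> to \<open>\<one> [v, u] + [v, u] \<one>\<close>, which is the degeneracy of \<open>[v, u]\<close> because
  \<open>\<theta>([v, u]) = 0\<close>.
\<close>

lemma degeneracy_face_after:
  assumes \<theta>: "lie_character scale bracket one \<theta>" and \<phi>: "multilinear \<phi>"
    and "1 \<le> j" "j < i" "i \<le> length vs"
  shows "degeneracy \<theta> j (face (i + 1) \<phi>) vs = face i (degeneracy \<theta> j \<phi>) vs"
proof -
  from list_two_slots[OF assms(3-5)]
  obtain us v ms u ws where vs: "vs = us @ v # ms @ u # ws"
    "j = Suc (length us)" "i = Suc (Suc (length us + length ms))" .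
  have zero: "\<phi> (xs @ 0 # ys) = 0" "\<phi> (xs @ x # 0 # ys) = 0" for xs x ys
    using functional_zero[OF multilinearD[OF \<phi>]] functional_zero[OF multilinearD[OF \<phi>, of "xs @ [x]"]]
    by simp_all
  show ?thesis
    using \<theta> by (simp add: vs lie_character_def degeneracy_at face_at ad_append ad_Cons ad_linear
      one_left zero algebra_simps cong: ad_cong)
qed

text \<open>
  Removing a letter \<open>\<one>\<close> just multiplies by \<open>\<epsilon>(\<one>)\<close>, and \<open>v\<close> acts on a preceding \<open>\<one>\<close> by zero. Hence
  the two faces interchange the contributions of \<open>\<one> v\<close> and \<open>v \<one>\<close>.
\<close>

lemma degeneracy_face_same:
  assumes \<theta>: "lie_character scale bracket one \<theta>" and \<phi>: "multilinear \<phi>"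
    and "1 \<le> i" "i \<le> length vs"
  shows "degeneracy \<theta> i (face i \<phi>) vs = degeneracy \<theta> i (face (i + 1) \<phi>) vs"
proof -
  from list_slot[OF assms(3,4)]
  obtain us v ws where vs: "vs = us @ v # ws" "i = Suc (length us)" .
  have zero: "\<phi> (xs @ 0 # ys) = 0" for xs ys
    using functional_zero[OF multilinearD[OF \<phi>]] by simp
  have one: "ad one (\<lambda>xs. \<phi> (xs @ ws)) us = 0" for us ws
    by (rule ad_one[OF multilinear_append1[OF \<phi>]])
  show ?thesis
    by (simp add: vs degeneracy_at face_at ad_append ad_Cons one one_left one_right zero algebra_simps)
qed

lemma weakly_simplicial_degeneracy_map:
  assumes \<theta>: "lie_character scale bracket one \<theta>"
  shows "weakly_simplicial scale face_map (degeneracy_map \<theta>)"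
proof -
  have lin: "functional \<theta>" using \<theta> by (simp add: lie_character_def)
  note s = degeneracy_map_lift(2)[OF lin]
  have d: "transpose_of (n + 1) n (face_map (n + 1) i) (face i)" if "1 \<le> i" "i \<le> n + 1" for n i
    using face_map_transpose[OF that] by simp
  have s': "transpose_of (n - 1) n (degeneracy_map \<theta> (n - 1) i) (degeneracy \<theta> i)" if "1 \<le> i" "i \<le> n - 1" for n i
    using s[OF that] that by simp
  show ?thesis
    unfolding weakly_simplicial_def
  proof (intro conjI allI impI ballI pre_simplicial_face_map)
    fix n i :: nat assume "1 \<le> i \<and> i \<le> n"
    then show "degeneracy_map \<theta> n i \<in> tensor_hom scale n (n + 1)"
      using degeneracy_map_lift(1)[OF lin] by blast
  next
    fix n i j :: nat and A assume ij: "1 \<le> i \<and> i \<le> j \<and> j \<le> n" and A: "A \<in> tensor_power scale n"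
    show "degeneracy_map \<theta> (n + 1) i (degeneracy_map \<theta> n j A) =
      degeneracy_map \<theta> (n + 1) (j + 1) (degeneracy_map \<theta> n i A)"
      by (rule transpose_eqI[OF transpose_compose[OF s s] transpose_compose[OF s s] A])
        (use ij degeneracy_degeneracy[OF \<theta>] in auto)
  next
    fix n i j :: nat and A assume ij: "1 \<le> i \<and> i < j \<and> j \<le> n" and A: "A \<in> tensor_power scale n"
    show "face_map (n + 1) i (degeneracy_map \<theta> n j A) = degeneracy_map \<theta> (n - 1) (j - 1) (face_map n i A)"
      by (rule transpose_eqI[OF transpose_compose[OF s d] transpose_compose[OF face_map_transpose s'] A])
        (use ij degeneracy_face_before in auto)
  next
    fix n i j :: nat and A assume ij: "1 \<le> j \<and> j + 1 < i \<and> i \<le> n + 1" and A: "A \<in> tensor_power scale n"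
    have i: "1 \<le> j" "j < i - 1" "i - 1 \<le> n" "i - 1 + 1 = i" using ij by auto
    have "degeneracy \<theta> j (face i \<phi>) vs = face (i - 1) (degeneracy \<theta> j \<phi>) vs"
      if "multilinear \<phi>" "length vs = n" for \<phi> vs
      using degeneracy_face_after[OF \<theta> that(1) i(1,2), of vs] i(3) that(2) unfolding i(4) by simp
    then show "face_map (n + 1) i (degeneracy_map \<theta> n j A) = degeneracy_map \<theta> (n - 1) j (face_map n (i - 1) A)"
      by (intro transpose_eqI[OF transpose_compose[OF s d] transpose_compose[OF face_map_transpose s'] A])
        (use ij in auto)
  next
    fix n i :: nat and A assume i: "1 \<le> i \<and> i \<le> n" and A: "A \<in> tensor_power scale n"
    show "face_map (n + 1) i (degeneracy_map \<theta> n i A) = face_map (n + 1) (i + 1) (degeneracy_map \<theta> n i A)"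
      by (rule transpose_eqI[OF transpose_compose[OF s d] transpose_compose[OF s d] A])
        (use i degeneracy_face_same[OF \<theta>] in auto)
  qed
qed

end

theorem proposition4p36:
  fixes scale :: "'k::field \<Rightarrow> 'v::ab_group_add \<Rightarrow> 'v"
    and bracket :: "'v \<Rightarrow> 'v \<Rightarrow> 'v"
    and one :: 'v
    and \<epsilon> :: "'v \<Rightarrow> 'k"
    and \<sigma> :: "('k, 'v) words set \<Rightarrow> ('k, 'v) words set"
    and D :: "nat \<Rightarrow> ('k, 'v) words set \<Rightarrow> ('k, 'v) words set"
  defines "\<sigma> \<equiv> leibniz_braiding scale bracket one"
    and "D \<equiv> left_braided_differential scale \<sigma> \<epsilon>"
  assumes "unital_leibniz scale bracket one"
    and "braided_character scale \<sigma> \<epsilon>"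
  shows "is_braiding scale \<sigma> \<and>
    (\<forall>\<epsilon>'. lie_character scale bracket one \<epsilon>' \<longrightarrow> braided_character scale \<sigma> \<epsilon>') \<and>
    tensor_differential scale D \<and>
    (\<forall>n vs. length vs = n \<longrightarrow>
       D n (pure_tensor scale vs) =
         tensor_class scale
           (free_scale (\<epsilon> one)
              (\<Sum>j\<in>{1..n}. \<Sum>i\<in>{1..<j}. free_scale ((-1) ^ (j - 1)) (word (bracket_omit bracket i j vs)))
            + (\<Sum>j\<in>{1..n}. free_scale ((-1) ^ (j - 1) * \<epsilon> (vs ! (j - 1))) (word (omit j vs))))) \<and>
    (\<exists>d. (\<forall>n j vs. 1 \<le> j \<and> j \<le> n \<and> length vs = n \<longrightarrow>
            d n j (pure_tensor scale vs) =
              tensor_class scale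
                (free_scale (\<epsilon> one) (\<Sum>i\<in>{1..<j}. word (bracket_omit bracket i j vs))
                 + free_scale (\<epsilon> (vs ! (j - 1))) (word (omit j vs)))) \<and>
         pre_simplicial scale d \<and>
         (\<forall>n. \<forall>A\<in>tensor_power scale n.
            D n A = tensor_sum scale (\<lambda>j. tensor_scale scale ((-1) ^ (j - 1)) (d n j A)) {1..n}) \<and>
         (\<forall>V'. leibniz_splitting scale bracket one V' \<longrightarrow>
            (\<exists>s. (\<forall>n i f. 1 \<le> i \<and> i \<le> n \<longrightarrow>
                    (leibniz_degeneracy scale one V' n i f \<longleftrightarrow> f = s n i)) \<and>
                 weakly_simplicial scale d s))) \<and>
    (\<epsilon> one = 1 \<longrightarrow> tensor_acyclic scale D)"
proof -
  interpret unital_leibniz scale bracket one by fact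
  have char: "Vector_Spaces.linear scale (*) \<epsilon>" "\<And>v w. \<epsilon> one * \<epsilon> (bracket v w) = 0"
    using assms(4) unfolding \<sigma>_def braided_character_iff by blast+
  interpret leibniz_braided_character scale bracket one \<epsilon>
    by (intro leibniz_braided_character.intro leibniz_braided_character_axioms.intro assms(3) char)
  note D_eq = D_def[unfolded \<sigma>_def]
  have faces: "\<forall>n j vs. 1 \<le> j \<and> j \<le> n \<and> length vs = n \<longrightarrow>
    face_map n j (pure_tensor scale vs) = tensor_class scale
      (free_scale (\<epsilon> one) (\<Sum>i\<in>{1..<j}. word (bracket_omit bracket i j vs))
        + free_scale (\<epsilon> (vs ! (j - 1))) (word (omit j vs)))"
    using face_map_pure by blast
  have degeneracies: "\<forall>V'. leibniz_splitting scale bracket one V' \<longrightarrow>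
    (\<exists>s. (\<forall>n i f. 1 \<le> i \<and> i \<le> n \<longrightarrow> (leibniz_degeneracy scale one V' n i f \<longleftrightarrow> f = s n i)) \<and>
      weakly_simplicial scale face_map s)"
  proof (intro allI impI)
    fix V' assume "leibniz_splitting scale bracket one V'"
    then obtain \<theta> where \<theta>: "lie_character scale bracket one \<theta>" and V': "V' = {v. \<theta> v = 0}"
      by (rule splitting_lie_character)
    show "\<exists>s. (\<forall>n i f. 1 \<le> i \<and> i \<le> n \<longrightarrow> (leibniz_degeneracy scale one V' n i f \<longleftrightarrow> f = s n i)) \<and>
      weakly_simplicial scale face_map s"
      unfolding V' using leibniz_degeneracy_iff[OF \<theta>] weakly_simplicial_degeneracy_map[OF \<theta>] by blast
  qed
  show ?thesis
    unfolding D_eq \<sigma>_def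
    by (intro conjI exI[of _ face_map] leibniz_braiding_is_braiding
        tensor_differential_D faces pre_simplicial_face_map degeneracies)
      (use lie_character_braided D_pure D_eq_sum_faces tensor_acyclic_D in simp_all)
qed

end
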